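(* Consider the top-$k$ multi-objective semi-bandit problem with $n$ arms and $d$ objectives over $T$ rounds, and the algorithm THV-UCB run with failure level $\delta=1/T$, all as defined in the context. Assume each reward coordinate is $\eta$-sub-Gaussian and bounded in $[0,1]$; for the gap-dependent term (the second entry of the minimum below), assume moreover that the greedy maximizer is unique at every stage of the construction of the greedy benchmark $G^\star$ and that the safe-pruning step never eliminates an arm of $G^\star$ (i.e. $G^\star\subseteq A_t$). Then the cumulative $\alpha$-approximation regret, $\alpha=1-1/e$, satisfies $$\mathbb E[\bar R_T]\;\le\;\min\Big\{O\big(\sqrt{nkT\log T}\big),\;O\Big(\frac{nk^{2.5}\log T}{\Delta_{\min}}\Big)\Big\}+O(1).$$ In particular $\mathbb E[\bar R_T]/T\to 0$: THV-UCB achieves sublinear $\alpha$-approximation regret on every instance.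
   Context: **Problem.** There are $n$ arms $[n]=\{1,\dots,n\}$, $d$ objectives, a horizon of $T$ rounds and a slate size $k\le n$. Pulling arm $i$ at round $t$ yields a random vector $\mathbf X_{i,t}\in[0,1]^d$ with unknown mean $\boldsymbol\mu_i=\mathbb E[\mathbf X_{i,t}]=(\mu_{i,1},\dots,\mu_{i,d})$. The vectors are independent across $t$ and $i$. Each coordinate is $\eta$-sub-Gaussian, with $\eta>0$ the variance proxy: $\mathbb E\,e^{\lambda(X_{i,t,j}-\mu_{i,j})}\le e^{\eta\lambda^2/2}$ for all $\lambda\in\mathbb R$. At each round the agent selects a set $S_t\subseteq[n]$ with $|S_t|=k$ and observes $\{\mathbf X_{i,t}:i\in S_t\}$. **Hypervolume.** Fix a reference point $\mathbf r\in\mathbb R^d$ with $\mathbf r\preceq\boldsymbol\mu_i$ (coordinate-wise $\le$) for all $i$. For $S\subseteq[n]$, $\mathrm{HV}(S)=\lambda_d\big(\bigcup_{i\in S}\prod_{j=1}^d[r_j,\mu_{i,j}]\big)$, where $\lambda_d$ is $d$-dimensional Lebesgue measure. **Regret.** $V^\star=\max_{|S|=k}\mathrm{HV}(S)$, $\alpha=1-1/e$, $\bar r_t=\alpha V^\star-\mathrm{HV}(S_t)$, $\bar R_T=\sum_{t=1}^T\bar r_t$. **Greedy benchmark and gaps.** Let $\Delta(i\mid S)=\mathrm{HV}(S\cup\{i\})-\mathrm{HV}(S)$. Put $G^\star_0=\emptyset$ and, for $\ell=1,\dots,k$, $i^\star_\ell\in\arg\max_{i\notin G^\star_{\ell-1}}\Delta(i\mid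 G^\star_{\ell-1})$, $G^\star_\ell=G^\star_{\ell-1}\cup\{i^\star_\ell\}$; $G^\star=G^\star_k$. The stage-$\ell$ gaps are $\Delta_\ell(i)=\Delta(i^\star_\ell\mid G^\star_{\ell-1})-\Delta(i\mid G^\star_{\ell-1})>0$ for $i\ne i^\star_\ell$, and $\Delta_{\min}=\min_{\ell\in[k]}\min_{i\ne i^\star_\ell}\Delta_\ell(i)$. **Algorithm THV-UCB.** Inputs: $k$, $\mathbf r$, $\eta$, $\delta\in(0,1)$, $T$, an integer $m_0\ge1$. $N_i(t)$ is the number of rounds $s\le t$ with $i\in S_s$, and $\widehat{\boldsymbol\mu}_i(t)$ is the empirical mean of the observations of arm $i$ up to round $t$ ($\mathbf 0$ if none). Initialization: while some arm has $N_i(t-1)<m_0$, play the $k$ arms with smallest $N_i(t-1)$ (ties broken arbitrarily). Main loop: at each subsequent round $t\le T$, set $$\beta_i(t)=\sqrt{\frac{2\eta\log(ndt^2/\delta)}{\max\{1,N_i(t-1)\}}},\quad \mathbf u_i(t)=\widehat{\boldsymbol\mu}_i(t-1)+\beta_i(t)\mathbf 1_d,\quad \mathbf L_i(t)=\widehat{\boldsymbol\mu}_i(t-1)-\beta_i(t)\mathbf 1_d.$$ Safe pruning: $A_t=\{i\in[n]:\forall j\ne i,\ \mathbf u_i(t)\not\preceq\mathbf L_j(t)\}$; if $|A_t|<k$, reset $A_t=[n]$. With $\mathrm{HV}^{\mathrm{UCB}}_t(S)=\lambda_d\big(\bigcup_{i\in S}\prod_{j=1}^d[r_j,u_{i,j}(t)]\big)$,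 build $S_t$ greedily: start from $S=\emptyset$ and, $k$ times, add to $S$ an element of $\arg\max_{i\in A_t\setminus S}\big(\mathrm{HV}^{\mathrm{UCB}}_t(S\cup\{i\})-\mathrm{HV}^{\mathrm{UCB}}_t(S)\big)$; then $S_t=S$ is played.
   Formalization: "E[R_T]/T → 0" is proved for the positive part, max(0, E[R_T]/T) → 0, since the signed regret can be linearly negative (n = k = 1, V* > 0 gives E[R_T]/T = −V*/e); the hidden constants may depend on d, r, η and m0. *)

theory Defs
  imports "HOL-Probability.Probability"
begin

section \<open>Hypervolume, greedy selection and gaps\<close>

text \<open>A box with \<open>v i $ j < r $ j\<close> for some \<open>j\<close> is empty and contributes nothing; this can happen
  for upper confidence vectors, never for the true means.\<close>

definition hypervolume :: "real^'d \<Rightarrow> (nat \<Rightarrow> real^'d) \<Rightarrow> nat set \<Rightarrow> real" where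
  "hypervolume r v S = measure lborel (\<Union>i\<in>S. cbox r (v i))"

definition marginal :: "(nat set \<Rightarrow> real) \<Rightarrow> nat set \<Rightarrow> nat \<Rightarrow> real" where
  "marginal f S i = f (insert i S) - f S"

text \<open>A list records the order in which a greedy construction picks its elements: stage \<open>l + 1\<close>
  picks \<open>xs ! l\<close>, and \<open>set (take l xs)\<close> has been built before. Ties are broken arbitrarily.\<close>

definition greedy_seq :: "(nat set \<Rightarrow> real) \<Rightarrow> nat set \<Rightarrow> nat list \<Rightarrow> bool" where
  "greedy_seq f A xs \<longleftrightarrow>
     (\<forall>l<length xs. is_arg_max (marginal f (set (take l xs))) (\<lambda>i. i \<in> A - set (take l xs)) (xs ! l))"

definition unique_greedy :: "(nat set \<Rightarrow> real) \<Rightarrow> nat set \<Rightarrow> nat list \<Rightarrow> bool" where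
  "unique_greedy f A xs \<longleftrightarrow>
     (\<forall>l<length xs. \<exists>!i. is_arg_max (marginal f (set (take l xs))) (\<lambda>i. i \<in> A - set (take l xs)) i)"

definition stage_gap :: "(nat set \<Rightarrow> real) \<Rightarrow> nat list \<Rightarrow> nat \<Rightarrow> nat \<Rightarrow> real" where
  "stage_gap f xs l i = marginal f (set (take l xs)) (xs ! l) - marginal f (set (take l xs)) i"

text \<open>Extended real, so that the minimum over the empty set (a single arm) is \<open>\<infinity>\<close>. In all other
  cases this is a minimum over finitely many reals.\<close>

definition min_gap :: "(nat set \<Rightarrow> real) \<Rightarrow> nat set \<Rightarrow> nat list \<Rightarrow> ereal" where
  "min_gap f A xs = (INF l\<in>{..<length xs}. INF i\<in>A - {xs ! l}. ereal (stage_gap f xs l i))"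


section \<open>The algorithm along one sample path\<close>

text \<open>\<open>S t\<close> is the slate played at round \<open>t\<close> and \<open>x i t\<close> the reward vector of arm \<open>i\<close> at round \<open>t\<close>,
  for \<open>t \<ge> 1\<close>. The rewards enter only through the rounds \<open>s\<close> with \<open>i \<in> S s\<close>.\<close>

definition pulls :: "(nat \<Rightarrow> nat set) \<Rightarrow> nat \<Rightarrow> nat \<Rightarrow> nat" where
  "pulls S i t = card {s \<in> {1..t}. i \<in> S s}"

definition emp_mean :: "(nat \<Rightarrow> nat set) \<Rightarrow> (nat \<Rightarrow> nat \<Rightarrow> real^'d) \<Rightarrow> nat \<Rightarrow> nat \<Rightarrow> real^'d" where
  "emp_mean S x i t = (\<Sum>s \<in> {s \<in> {1..t}. i \<in> S s}. x i s) /\<^sub>R real (pulls S i t)"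

definition conf_radius ::
  "nat \<Rightarrow> nat \<Rightarrow> real \<Rightarrow> real \<Rightarrow> (nat \<Rightarrow> nat set) \<Rightarrow> nat \<Rightarrow> nat \<Rightarrow> real" where
  "conf_radius n d \<eta> \<delta> S i t =
     sqrt (2 * \<eta> * ln (real n * real d * (real t)\<^sup>2 / \<delta>) / max 1 (real (pulls S i (t - 1))))"

definition ucb ::
  "nat \<Rightarrow> real \<Rightarrow> real \<Rightarrow> (nat \<Rightarrow> nat set) \<Rightarrow> (nat \<Rightarrow> nat \<Rightarrow> real^'d) \<Rightarrow> nat \<Rightarrow> nat \<Rightarrow> real^'d" where
  "ucb n \<eta> \<delta> S x t i = emp_mean S x i (t - 1) + vec (conf_radius n CARD('d) \<eta> \<delta> S i t)"

definition lcb ::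
  "nat \<Rightarrow> real \<Rightarrow> real \<Rightarrow> (nat \<Rightarrow> nat set) \<Rightarrow> (nat \<Rightarrow> nat \<Rightarrow> real^'d) \<Rightarrow> nat \<Rightarrow> nat \<Rightarrow> real^'d" where
  "lcb n \<eta> \<delta> S x t i = emp_mean S x i (t - 1) - vec (conf_radius n CARD('d) \<eta> \<delta> S i t)"

definition unpruned ::
  "nat \<Rightarrow> real \<Rightarrow> real \<Rightarrow> (nat \<Rightarrow> nat set) \<Rightarrow> (nat \<Rightarrow> nat \<Rightarrow> real^'d) \<Rightarrow> nat \<Rightarrow> nat set" where
  "unpruned n \<eta> \<delta> S x t =
     {i \<in> {1..n}. \<forall>j \<in> {1..n} - {i}. \<not> ucb n \<eta> \<delta> S x t i \<le> lcb n \<eta> \<delta> S x t j}"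

definition active_arms ::
  "nat \<Rightarrow> nat \<Rightarrow> real \<Rightarrow> real \<Rightarrow> (nat \<Rightarrow> nat set) \<Rightarrow> (nat \<Rightarrow> nat \<Rightarrow> real^'d) \<Rightarrow> nat \<Rightarrow> nat set" where
  "active_arms n k \<eta> \<delta> S x t =
     (if card (unpruned n \<eta> \<delta> S x t) < k then {1..n} else unpruned n \<eta> \<delta> S x t)"

definition init_round :: "nat \<Rightarrow> nat \<Rightarrow> (nat \<Rightarrow> nat set) \<Rightarrow> nat \<Rightarrow> bool" where
  "init_round n m0 S t \<longleftrightarrow> (\<exists>i\<in>{1..n}. pulls S i (t - 1) < m0)"

definition least_pulled :: "nat \<Rightarrow> nat \<Rightarrow> (nat \<Rightarrow> nat set) \<Rightarrow> nat \<Rightarrow> bool" where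
  "least_pulled n k S t \<longleftrightarrow> S t \<subseteq> {1..n} \<and> card (S t) = k \<and>
     (\<forall>i\<in>S t. \<forall>j\<in>{1..n} - S t. pulls S i (t - 1) \<le> pulls S j (t - 1))"

definition thv_ucb_path ::
  "nat \<Rightarrow> nat \<Rightarrow> nat \<Rightarrow> real^'d \<Rightarrow> real \<Rightarrow> real \<Rightarrow> nat \<Rightarrow> (nat \<Rightarrow> nat set) \<Rightarrow> (nat \<Rightarrow> nat \<Rightarrow> real^'d) \<Rightarrow> bool"
  where
  "thv_ucb_path n k T r \<eta> \<delta> m0 S x \<longleftrightarrow>
     (\<forall>t\<in>{1..T}.
        if init_round n m0 S t then least_pulled n k S t
        else (\<exists>xs. length xs = k \<and>
                   greedy_seq (hypervolume r (ucb n \<eta> \<delta> S x t)) (active_arms n k \<eta> \<delta> S x t) xs \<and>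
                   S t = set xs))"


section \<open>Regret\<close>

definition opt_value :: "nat \<Rightarrow> nat \<Rightarrow> real^'d \<Rightarrow> (nat \<Rightarrow> real^'d) \<Rightarrow> real" where
  "opt_value n k r \<mu> = Max (hypervolume r \<mu> ` {S. S \<subseteq> {1..n} \<and> card S = k})"

definition approx_regret ::
  "nat \<Rightarrow> nat \<Rightarrow> nat \<Rightarrow> real^'d \<Rightarrow> (nat \<Rightarrow> real^'d) \<Rightarrow> (nat \<Rightarrow> nat set) \<Rightarrow> real" where
  "approx_regret n k T r \<mu> S =
     (\<Sum>t\<in>{1..T}. (1 - 1 / exp 1) * opt_value n k r \<mu> - hypervolume r \<mu> (S t))"


section \<open>The stochastic model\<close>

locale semi_bandit = prob_space M
  for M :: "'a measure" +
  fixes n T :: nat and \<eta> :: real and \<mu> :: "nat \<Rightarrow> real^'d" and X :: "nat \<Rightarrow> nat \<Rightarrow> 'a \<Rightarrow> real^'d"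
  assumes \<eta>_pos: "\<eta> > 0"
    and rewards_bounded: "\<And>i t \<omega>. i \<in> {1..n} \<Longrightarrow> t \<in> {1..T} \<Longrightarrow> \<omega> \<in> space M \<Longrightarrow> X i t \<omega> \<in> cbox 0 1"
    and rewards_indep: "indep_vars (\<lambda>_. borel) (\<lambda>(i, t). X i t) ({1..n} \<times> {1..T})"
    and rewards_mean: "\<And>i t. i \<in> {1..n} \<Longrightarrow> t \<in> {1..T} \<Longrightarrow> expectation (X i t) = \<mu> i"
    and rewards_subgaussian: "\<And>i t j l. i \<in> {1..n} \<Longrightarrow> t \<in> {1..T} \<Longrightarrow>
          expectation (\<lambda>\<omega>. exp (l * (X i t \<omega> $ j - \<mu> i $ j))) \<le> exp (\<eta> * l\<^sup>2 / 2)"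

text \<open>\<open>F t\<close> is the information available after round \<open>t\<close>. It contains the rewards of the rounds up to
  \<open>t\<close>, possibly together with extra randomness used for breaking ties; the slate of the next round
  is determined by it, and the rewards of the next round are independent of it.\<close>

locale thv_ucb_run = semi_bandit M n T \<eta> \<mu> X + filtration "space M" F
  for M :: "'a measure" and n k T :: nat and r :: "real^'d" and \<eta> \<delta> :: real and m0 :: nat
    and \<mu> :: "nat \<Rightarrow> real^'d" and X :: "nat \<Rightarrow> nat \<Rightarrow> 'a \<Rightarrow> real^'d"
    and F :: "nat \<Rightarrow> 'a measure" and S :: "nat \<Rightarrow> 'a \<Rightarrow> nat set" +
  assumes k_pos: "1 \<le> k" and k_le: "k \<le> n"
    and m0_pos: "1 \<le> m0"
    and \<delta>_pos: "0 < \<delta>" and \<delta>_less: "\<delta> < 1"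
    and ref_point: "\<And>i. i \<in> {1..n} \<Longrightarrow> r \<le> \<mu> i"
    and F_sub: "\<And>t. subalgebra M (F t)"
    and rewards_adapted:
      "\<And>i s t. i \<in> {1..n} \<Longrightarrow> s \<in> {1..T} \<Longrightarrow> s \<le> t \<Longrightarrow> X i s \<in> borel_measurable (F t)"
    and slate_predictable: "\<And>t. t \<in> {1..T} \<Longrightarrow> S t \<in> measurable (F (t - 1)) (count_space UNIV)"
    and rewards_fresh: "\<And>t. t \<in> {1..T} \<Longrightarrow>
          indep_set (sets (F (t - 1)))
            (sets (vimage_algebra (space M) (\<lambda>\<omega>. \<lambda>i\<in>{1..n}. X i t \<omega>) (PiM {1..n} (\<lambda>_. borel))))"
    and follows_algorithm: "\<And>\<omega>. \<omega> \<in> space M \<Longrightarrow>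
          thv_ucb_path n k T r \<eta> \<delta> m0 (\<lambda>t. S t \<omega>) (\<lambda>i t. X i t \<omega>)"

end

(* On the event that all confidence intervals hold, the optimistic hypervolume of any slate is at
   least its true hypervolume, and pruning loses nothing because every pruned arm is dominated by a
   surviving one. The greedy slate is therefore within the factor 1 - 1/e of the optimum for the
   optimistic hypervolume, so a round's regret is at most the overestimation on the slate played,
   which is a constant times the sum of the confidence radii of its arms. Likewise, if the greedy
   choice first deviates from the benchmark at some stage, that stage's gap is at most this sum.
   Summing 1 / sqrt m over the pulls of each arm gives the two rates. The confidence intervals fail
   in a given round with probability at most 2 / T, by the exponential supermartingale of the
   centred rewards collected from an arm, in which an unplayed round contributes a factor 1. *)

theory Submission
  imports Defs "HOL-Real_Asymp.Real_Asymp"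
begin

section \<open>Hypervolume and greedy selection\<close>

text \<open>The constants must be fixed before \<open>n\<close>, \<open>k\<close>, \<open>T\<close>
  and \<open>\<mu>\<close>, so they may depend only on \<open>r\<close>, \<open>\<eta>\<close>,
  \<open>m0\<close> and the dimension. Two obstacles shape the proof. Box volume is Lipschitz only
  on a bounded region, while radii can be arbitrarily large; \<open>hv_lip r\<close> is therefore
  chosen to bound every hypervolume of means as well, so that a radius above 1 makes the estimate
  trivial. And \<open>n\<close> enters the logarithm of the radius and the initialization cost of up
  to \<open>n * m0\<close> rounds. The rates are proved separately for \<open>n \<le> T\<close>,
  where \<open>ln n\<close> is at most \<open>ln T\<close> and the initialization fits into the
  rate, and for \<open>T < n\<close>, where the trivial bound \<open>hv_lip r * T\<close> does. In
  the gap bound the charge for a round is its overestimation rather than a full unit of volume.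
  Summed over the pulls whose radius exceeds a threshold \<open>c\<close>, radii of the form
  \<open>a / sqrt m\<close> give the order of \<open>a\<^sup>2 / c\<close>, whereas counting those
  pulls gives \<open>a\<^sup>2 / c\<^sup>2\<close>; this is why the gap appears to the first
  power.\<close>

lemma boxes_fmeasurable: "finite S \<Longrightarrow> (\<Union>i\<in>S. cbox r (v i)) \<in> fmeasurable lborel"
  by (intro fmeasurable.finite_UN) (auto simp: fmeasurable_cbox)

lemma hypervolume_empty [simp]: "hypervolume r v {} = 0"
  by (simp add: hypervolume_def)

lemma hypervolume_nonneg [simp]: "0 \<le> hypervolume r v S"
  by (simp add: hypervolume_def)

text \<open>Letting the dominating index vary covers three uses at once: raising the corners of a
  fixed slate, replacing pruned arms by survivors, and comparing any slate with the single box
  \<open>cbox r 1\<close>.\<close>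

lemma hypervolume_le_dominating:
  assumes "finite A" "finite B" and dom: "\<And>i. i \<in> A \<Longrightarrow> \<exists>j\<in>B. v i \<le> w j"
  shows "hypervolume r v A \<le> hypervolume r w B"
proof -
  have "(\<Union>i\<in>A. cbox r (v i)) \<subseteq> (\<Union>j\<in>B. cbox r (w j))"
  proof
    fix y assume "y \<in> (\<Union>i\<in>A. cbox r (v i))"
    then obtain i where i: "i \<in> A" "y \<in> cbox r (v i)" by blast
    from dom[OF i(1)] obtain j where "j \<in> B" "v i \<le> w j" by blast
    with i show "y \<in> (\<Union>j\<in>B. cbox r (w j))"
      by (auto simp: mem_box_cart less_eq_vec_def intro!: bexI[of _ j] intro: order_trans)
  qed
  then show ?thesis
    unfolding hypervolume_def
    using assms by (intro measure_mono_fmeasurable boxes_fmeasurable fmeasurableD)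
qed

text \<open>In this form a marginal is the volume newly covered, which makes it nonnegative without
  further argument.\<close>

lemma marginal_hypervolume:
  assumes "finite P"
  shows "marginal (hypervolume r v) P i = measure lborel (cbox r (v i) - (\<Union>j\<in>P. cbox r (v j)))"
proof -
  let ?U = "\<Union>j\<in>P. cbox r (v j)"
  have "measure lborel (?U \<union> cbox r (v i)) = measure lborel ?U + measure lborel (cbox r (v i) - ?U)"
    using boxes_fmeasurable[OF assms, of r v] by (intro measure_Un2) (auto simp: fmeasurable_cbox)
  then show ?thesis
    by (simp add: marginal_def hypervolume_def Un_commute)
qed

lemma marginal_hypervolume_nonneg: "finite P \<Longrightarrow> 0 \<le> marginal (hypervolume r v) P i"
  by (simp add: marginal_hypervolume)

text \<open>This is submodularity in the form used by the greedy analysis: what \<open>B\<close>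
  covers outside \<open>P\<close> is the union of the new parts of its boxes, and a union bound
  applies.\<close>

lemma hypervolume_le_sum_marginal:
  assumes "finite P" "finite B"
  shows "hypervolume r v B \<le> hypervolume r v P + (\<Sum>i\<in>B. marginal (hypervolume r v) P i)"
proof -
  let ?U = "\<Union>j\<in>P. cbox r (v j)"
  have U: "?U \<in> fmeasurable lborel" by (rule boxes_fmeasurable[OF assms(1)])
  have D: "(\<Union>i\<in>B. cbox r (v i) - ?U) \<in> fmeasurable lborel"
    using assms U by (intro fmeasurable.finite_UN fmeasurable.Diff) (auto simp: fmeasurable_cbox)
  have "hypervolume r v B \<le> measure lborel (?U \<union> (\<Union>i\<in>B. cbox r (v i) - ?U))"
    unfolding hypervolume_def using U D boxes_fmeasurable[OF assms(2), of r v]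
    by (intro measure_mono_fmeasurable fmeasurable.Un) (auto dest: fmeasurableD)
  also have "\<dots> \<le> measure lborel ?U + measure lborel (\<Union>i\<in>B. cbox r (v i) - ?U)"
    using U D by (intro measure_Un_le) (auto dest: fmeasurableD)
  also have "measure lborel (\<Union>i\<in>B. cbox r (v i) - ?U) \<le> (\<Sum>i\<in>B. measure lborel (cbox r (v i) - ?U))"
    using assms(2) U by (intro measure_UNION_le) (auto dest: fmeasurableD)
  finally show ?thesis
    by (simp add: marginal_hypervolume[OF assms(1)] hypervolume_def)
qed

section \<open>Greedy sequences and the factor 1 - 1/e\<close>

lemma greedy_seq_nth:
  assumes "greedy_seq f A xs" "l < length xs"
  shows "xs ! l \<in> A - set (take l xs)"
    and "\<And>i. i \<in> A - set (take l xs) \<Longrightarrow> marginal f (set (take l xs)) i \<le> marginal f (set (take l xs)) (xs ! l)"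
  using assms by (auto simp: greedy_seq_def is_arg_max_linorder)

lemma greedy_seq_subset: "greedy_seq f A xs \<Longrightarrow> set xs \<subseteq> A"
  using greedy_seq_nth(1) by (fastforce simp: in_set_conv_nth)

lemma greedy_seq_distinct:
  assumes "greedy_seq f A xs"
  shows "distinct xs"
proof -
  have *: "xs ! l \<noteq> xs ! l'" if "l' < l" "l < length xs" for l l'
  proof -
    have "xs ! l' \<in> set (take l xs)"
      using that by (auto simp: in_set_conv_nth intro!: exI[of _ l'])
    then show ?thesis using greedy_seq_nth(1)[OF assms that(2)] by auto
  qed
  show ?thesis
    unfolding distinct_conv_nth using * by (metis nat_neq_iff)
qed

text \<open>The best available marginal is at least the average over \<open>B\<close>. Arms of
  \<open>B\<close> that are already picked do not compete in the argmax, but their marginal is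
  0.\<close>

lemma greedy_hypervolume_step:
  assumes g: "greedy_seq (hypervolume r v) A xs" and l: "l < length xs"
    and B: "B \<subseteq> A" "finite A" "card B \<le> k"
  shows "hypervolume r v B - hypervolume r v (set (take l xs))
     \<le> real k * (hypervolume r v (set (take (Suc l) xs)) - hypervolume r v (set (take l xs)))"
proof -
  let ?P = "set (take l xs)" and ?f = "hypervolume r v"
  have finB: "finite B" using B finite_subset by blast
  have m: "marginal ?f ?P i \<le> marginal ?f ?P (xs ! l)" if "i \<in> B" for i
  proof (cases "i \<in> ?P")
    case True
    then have "marginal ?f ?P i = 0" by (simp add: marginal_def insert_absorb)
    then show ?thesis by (simp add: marginal_hypervolume_nonneg)
  next
    case False
    then show ?thesis using greedy_seq_nth(2)[OF g l] that B by blast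
  qed
  have "?f B - ?f ?P \<le> (\<Sum>i\<in>B. marginal ?f ?P i)"
    using hypervolume_le_sum_marginal[of ?P B r v] finB by simp
  also have "\<dots> \<le> real (card B) * marginal ?f ?P (xs ! l)"
    using sum_bounded_above[of B "marginal ?f ?P" "marginal ?f ?P (xs ! l)"] m by simp
  also have "\<dots> \<le> real k * marginal ?f ?P (xs ! l)"
    using B(3) by (intro mult_right_mono marginal_hypervolume_nonneg) auto
  also have "marginal ?f ?P (xs ! l) = ?f (set (take (Suc l) xs)) - ?f ?P"
    using l by (simp add: marginal_def take_Suc_conv_app_nth)
  finally show ?thesis .
qed

text \<open>Each pick shrinks the distance to the value of \<open>B\<close> by the factor
  \<open>1 - 1 / k\<close>, and \<open>k\<close> such factors multiply to at most
  \<open>1 / e\<close>. \<open>B\<close> may have fewer than \<open>k\<close> elements because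
  several pruned arms can share one surviving replacement.\<close>

lemma greedy_hypervolume:
  assumes g: "greedy_seq (hypervolume r v) A xs" and k: "length xs = k" "1 \<le> k"
    and B: "B \<subseteq> A" "finite A" "card B \<le> k"
  shows "(1 - 1 / exp 1) * hypervolume r v B \<le> hypervolume r v (set xs)"
proof -
  let ?f = "hypervolume r v"
  have k0: "real k > 0" using k by simp
  have step: "?f B - ?f (set (take l xs)) \<le> (1 - 1 / real k) ^ l * ?f B" if "l \<le> k" for l
    using that
  proof (induction l)
    case (Suc l)
    let ?a = "?f (set (take l xs))" and ?b = "?f (set (take (Suc l) xs))"
    have "?f B - ?a \<le> real k * (?b - ?a)"
      using greedy_hypervolume_step[OF g _ B, of l] Suc.prems k by simp
    then have "?f B - ?b \<le> (1 - 1 / real k) * (?f B - ?a)"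
      using k0 by (simp add: field_simps)
    also have "\<dots> \<le> (1 - 1 / real k) * ((1 - 1 / real k) ^ l * ?f B)"
      using Suc k by (intro mult_left_mono) auto
    finally show ?case by simp
  qed simp
  have "(1 - 1 / real k) ^ k \<le> exp (- 1 / real k) ^ k"
    using k exp_ge_add_one_self[of "- 1 / real k"] by (intro power_mono) auto
  also have "\<dots> = exp (- 1)"
    using k0 by (simp flip: exp_of_nat_mult)
  finally have "(1 - 1 / real k) ^ k * ?f B \<le> exp (- 1) * ?f B"
    by (intro mult_right_mono) auto
  with step[of k] k show ?thesis
    by (simp add: algebra_simps exp_minus inverse_eq_divide)
qed

section \<open>Lipschitz dependence of box volume on the upper corner\<close>

text \<open>The factors are exchanged one at a time. Since \<open>1 \<le> b\<close>, the power
  \<open>card J\<close> can be used throughout in place of the sharper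
  \<open>card J - 1\<close>.\<close>

lemma prod_diff_le:
  fixes f g :: "'i \<Rightarrow> real"
  assumes "finite J" "1 \<le> b" "\<And>j. j \<in> J \<Longrightarrow> 0 \<le> g j \<and> g j \<le> f j \<and> f j \<le> b"
  shows "prod f J - prod g J \<le> b ^ card J * (\<Sum>j\<in>J. f j - g j)"
  using assms
proof (induction J)
  case (insert a J)
  have le: "prod g J \<le> b ^ card J" "prod g J \<le> prod f J"
    using insert.prems prod_mono[of J g "\<lambda>_. b"] prod_mono[of J g f] by (force)+
  have "prod f (insert a J) - prod g (insert a J)
      = f a * (prod f J - prod g J) + (f a - g a) * prod g J"
    using insert.hyps by (simp add: algebra_simps)
  also have "\<dots> \<le> b * (b ^ card J * (\<Sum>j\<in>J. f j - g j)) + (f a - g a) * (b * b ^ card J)"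
  proof (intro add_mono mult_mono)
    show "prod f J - prod g J \<le> b ^ card J * (\<Sum>j\<in>J. f j - g j)"
      using insert by auto
    have "1 * b ^ card J \<le> b * b ^ card J"
      using insert.prems by (intro mult_right_mono) auto
    then show "prod g J \<le> b * b ^ card J" using le by linarith
    show "0 \<le> prod g J" using insert.prems by (intro prod_nonneg) auto
  qed (use insert.prems le in auto)
  also have "\<dots> = b ^ card (insert a J) * (\<Sum>j\<in>insert a J. f j - g j)"
    using insert.hyps by (simp add: algebra_simps)
  finally show ?case .
qed simp

text \<open>A Lipschitz constant of the volume of a box with lower corner \<open>r\<close> and upper corner at most
  \<open>3\<close>, where \<open>3\<close> is the upper bound \<open>1\<close> on the means plus twice a confidence radius of at most \<open>1\<close>.\<close>

definition hv_lip :: "real^'d \<Rightarrow> real" where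
  "hv_lip r = 2 * real CARD('d) * (3 + norm r) ^ CARD('d)"

lemma hv_lip_pos: "0 < hv_lip r"
proof -
  have "0 < 3 + norm r" by (simp add: add_pos_nonneg)
  then show ?thesis by (simp add: hv_lip_def)
qed

lemma measure_cbox_vec:
  fixes r v :: "real^'d"
  assumes "r \<le> v"
  shows "measure lborel (cbox r v) = (\<Prod>j\<in>UNIV. v $ j - r $ j)"
  using assms by (intro content_cbox_cart) (auto simp: less_eq_vec_def interval_ne_empty_cart)

text \<open>The Lipschitz constant doubles as a bound on the total volume available to the means. It
  prices the rounds in which no confidence bound can be used.\<close>

lemma measure_unit_box_le: "measure lborel (cbox r (1::real^'d)) \<le> hv_lip r"
proof (cases "r \<le> 1")
  case True
  have c: "1 - r $ j \<le> 3 + norm r" for j using component_le_norm_cart[of r j] by linarith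
  have "measure lborel (cbox r 1) \<le> (\<Prod>j\<in>(UNIV::'d set). 3 + norm r)"
    unfolding measure_cbox_vec[OF True] using True c by (intro prod_mono) (auto simp: less_eq_vec_def)
  also have "\<dots> = 1 * (3 + norm r) ^ CARD('d)" by simp
  also have "\<dots> \<le> hv_lip r"
  proof -
    have "1 \<le> CARD('d)" by (simp add: Suc_leI)
    then have "1 \<le> 2 * real CARD('d)" by linarith
    then show ?thesis unfolding hv_lip_def by (intro mult_right_mono) auto
  qed
  finally show ?thesis .
next
  case False
  then have "cbox r 1 = {}" by (auto simp: less_eq_vec_def interval_eq_empty_cart not_le)
  then show ?thesis using hv_lip_pos[of r] by simp
qed

lemma hypervolume_le_hv_lip:
  assumes "finite S" "\<And>i. i \<in> S \<Longrightarrow> v i \<le> 1"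
  shows "hypervolume r v S \<le> hv_lip r"
proof -
  have "hypervolume r v S \<le> hypervolume r (\<lambda>_. 1) {0}"
    using assms by (intro hypervolume_le_dominating) auto
  also have "\<dots> \<le> hv_lip r"
    using measure_unit_box_le[of r] by (simp add: hypervolume_def)
  finally show ?thesis .
qed

lemma measure_cbox_diff_le:
  fixes r v w :: "real^'d"
  assumes "r \<le> v" "v \<le> 1" "v \<le> w" "w \<le> v + vec (2 * b)" "b \<le> 1"
  shows "measure lborel (cbox r w) - measure lborel (cbox r v) \<le> hv_lip r * b"
proof -
  have c: "0 \<le> v $ j - r $ j \<and> v $ j - r $ j \<le> w $ j - r $ j \<and> w $ j - r $ j \<le> 3 + norm r" for j
    using assms component_le_norm_cart[of r j] 
    by (auto simp: less_eq_vec_def dest!: spec[where x=j])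
  have "r \<le> w" using assms by order
  then have "measure lborel (cbox r w) - measure lborel (cbox r v)
      \<le> (3 + norm r) ^ CARD('d) * (\<Sum>j\<in>(UNIV::'d set). (w $ j - r $ j) - (v $ j - r $ j))"
    using assms c by (simp only: measure_cbox_vec) (intro prod_diff_le, auto)
  also have "\<dots> \<le> (3 + norm r) ^ CARD('d) * (\<Sum>j\<in>(UNIV::'d set). 2 * b)"
    using assms by (intro mult_left_mono sum_mono) (auto simp: less_eq_vec_def algebra_simps)
  finally show ?thesis by (simp add: hv_lip_def mult_ac)
qed

section \<open>Greedy selection under confidence bounds\<close>

text \<open>One main-loop round on the good event, stripped of probability. The slack
  \<open>2 * \<beta>\<close> is one radius for the estimation error and one for the optimistic
  shift; strictness of \<open>lower_less_upper\<close> rules out cycles in the elimination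
  relation.\<close>

locale confidence_bounds =
  fixes I :: "nat set" and r :: "real^'d" and \<mu> u l :: "nat \<Rightarrow> real^'d" and \<beta> :: "nat \<Rightarrow> real"
  assumes finite_arms: "finite I"
    and r_le: "\<And>i. i \<in> I \<Longrightarrow> r \<le> \<mu> i"
    and mean_le_1: "\<And>i. i \<in> I \<Longrightarrow> \<mu> i \<le> 1"
    and lower: "\<And>i. i \<in> I \<Longrightarrow> l i \<le> \<mu> i"
    and upper: "\<And>i. i \<in> I \<Longrightarrow> \<mu> i \<le> u i"
    and upper_le: "\<And>i. i \<in> I \<Longrightarrow> u i \<le> \<mu> i + vec (2 * \<beta> i)"
    and lower_less_upper: "\<And>i c. i \<in> I \<Longrightarrow> l i $ c < u i $ c"
begin

text \<open>This and \<open>active\<close> copy the bodies of \<open>unpruned\<close> and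
  \<open>active_arms\<close> over abstract bounds, so that the two versions agree by unfolding
  alone.\<close>

definition survivors :: "nat set" where
  "survivors = {i \<in> I. \<forall>j \<in> I - {i}. \<not> u i \<le> l j}"

definition active :: "nat \<Rightarrow> nat set" where
  "active k = (if card survivors < k then I else survivors)"

lemma active_subset: "active k \<subseteq> I"
  by (auto simp: active_def survivors_def)

lemma radius_nonneg: "i \<in> I \<Longrightarrow> 0 \<le> \<beta> i"
  using order_trans[OF upper upper_le, of i] by (simp add: less_eq_vec_def)

lemma hypervolume_mean_le: "S \<subseteq> I \<Longrightarrow> hypervolume r \<mu> S \<le> hv_lip r"
  using finite_arms mean_le_1 by (intro hypervolume_le_hv_lip) (auto intro: finite_subset)

text \<open>Following the elimination relation upwards from a pruned arm strictly
  increases every coordinate of the upper bound, so it ends in a surviving arm with a larger mean.\<close>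

lemma dominated_by_survivor:
  assumes i: "i \<in> I"
  shows "\<exists>j\<in>survivors. \<mu> i \<le> \<mu> j"
proof -
  fix c :: 'd
  \<comment> \<open>A maximizer of one coordinate of \<open>u\<close> over \<open>?D\<close>
    replaces the ascending chain: any arm eliminating a member of \<open>?D\<close> is again in
    \<open>?D\<close>, by transitivity through \<open>l j \<le> u j\<close>.\<close>
  let ?D = "{j \<in> I. j = i \<or> u i \<le> l j}"
  have "finite ?D" "?D \<noteq> {}" using finite_arms i by auto
  then obtain j where j: "j \<in> ?D" and max: "\<And>j'. j' \<in> ?D \<Longrightarrow> u j' $ c \<le> u j $ c"
    using Max_in[of "(\<lambda>j. u j $ c) ` ?D"] Max_ge[of "(\<lambda>j. u j $ c) ` ?D"] by fastforce
  have "j \<in> survivors"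
  proof (rule ccontr)
    assume "j \<notin> survivors"
    then obtain j' where j': "j' \<in> I" "u j \<le> l j'" using j by (auto simp: survivors_def)
    have "l j \<le> u j" using lower[of j] upper[of j] j by auto
    then have "j' \<in> ?D" using j j' by (auto intro: order_trans)
    then have "u j' $ c \<le> u j $ c" by (rule max)
    also have "\<dots> \<le> l j' $ c" using j'(2) by (simp add: less_eq_vec_def)
    also have "\<dots> < u j' $ c" using j' lower_less_upper by blast
    finally show False by simp
  qed
  moreover have "\<mu> i \<le> \<mu> j"
    using j upper[OF i] lower[of j] by (auto intro: order_trans)
  ultimately show ?thesis by blast
qed

text \<open>Both branches of \<open>active\<close> contain the survivors, so the reset after
  excessive pruning needs no separate argument. Arms of \<open>B\<close> may share a survivor, hence
  only an inequality between the cardinalities.\<close>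

lemma dominated_by_active:
  assumes B: "B \<subseteq> I"
  obtains B' where "B' \<subseteq> active k" "card B' \<le> card B" "hypervolume r \<mu> B \<le> hypervolume r \<mu> B'"
proof -
  obtain \<phi> where \<phi>: "\<And>i. i \<in> I \<Longrightarrow> \<phi> i \<in> survivors \<and> \<mu> i \<le> \<mu> (\<phi> i)"
    using dominated_by_survivor by metis
  have fin: "finite B" using B finite_arms finite_subset by blast
  show ?thesis
  proof (rule that[of "\<phi> ` B"])
    show "\<phi> ` B \<subseteq> active k" using \<phi> B by (auto simp: active_def survivors_def)
    show "card (\<phi> ` B) \<le> card B" using fin by (rule card_image_le)
    show "hypervolume r \<mu> B \<le> hypervolume r \<mu> (\<phi> ` B)"
      using \<phi> B fin by (intro hypervolume_le_dominating) auto
  qed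
qed

lemma hypervolume_upper_ge: "S \<subseteq> I \<Longrightarrow> hypervolume r \<mu> S \<le> hypervolume r u S"
  using upper finite_arms by (intro hypervolume_le_dominating) (auto intro: finite_subset)

text \<open>The optimistic region is covered by the true one together with the shells between the
  true and the optimistic box of each arm, and each shell is controlled by the Lipschitz
  bound.\<close>

lemma hypervolume_upper_le:
  assumes S: "S \<subseteq> I" and b: "\<And>i. i \<in> S \<Longrightarrow> \<beta> i \<le> 1"
  shows "hypervolume r u S \<le> hypervolume r \<mu> S + hv_lip r * (\<Sum>i\<in>S. \<beta> i)"
proof -
  have fin: "finite S" using S finite_arms finite_subset by blast
  let ?E = "\<Union>i\<in>S. cbox r (u i) - cbox r (\<mu> i)"
  have E: "?E \<in> fmeasurable lborel"
    using fin by (intro fmeasurable.finite_UN fmeasurable.Diff) (auto simp: fmeasurable_cbox)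
  have U: "(\<Union>i\<in>S. cbox r (\<mu> i)) \<in> fmeasurable lborel" by (rule boxes_fmeasurable[OF fin])
  have "hypervolume r u S \<le> measure lborel ((\<Union>i\<in>S. cbox r (\<mu> i)) \<union> ?E)"
    unfolding hypervolume_def using E U boxes_fmeasurable[OF fin, of r u]
    by (intro measure_mono_fmeasurable fmeasurable.Un) (auto dest: fmeasurableD)
  also have "\<dots> \<le> hypervolume r \<mu> S + measure lborel ?E"
    unfolding hypervolume_def using U E by (intro measure_Un_le) (auto dest: fmeasurableD)
  also have "measure lborel ?E \<le> (\<Sum>i\<in>S. measure lborel (cbox r (u i) - cbox r (\<mu> i)))"
    using fin by (intro measure_UNION_le) auto
  also have "\<dots> \<le> (\<Sum>i\<in>S. hv_lip r * \<beta> i)"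
  proof (intro sum_mono)
    fix i assume i: "i \<in> S"
    then have iI: "i \<in> I" using S by auto
    have "cbox r (\<mu> i) \<subseteq> cbox r (u i)"
      using upper[OF iI] unfolding less_eq_vec_def subset_iff mem_box_cart by (meson order_trans)
    then have "measure lborel (cbox r (u i) - cbox r (\<mu> i))
        = measure lborel (cbox r (u i)) - measure lborel (cbox r (\<mu> i))"
      using emeasure_lborel_cbox_finite[of r "u i"] by (intro measure_Diff) auto
    also have "\<dots> \<le> hv_lip r * \<beta> i"
      using iI b[OF i] by (intro measure_cbox_diff_le r_le mean_le_1 upper upper_le)
    finally show "measure lborel (cbox r (u i) - cbox r (\<mu> i)) \<le> hv_lip r * \<beta> i" .
  qed
  finally show ?thesis by (simp add: sum_distrib_left)
qed

text \<open>If some radius exceeds 1, the right-hand side already exceeds the total volume.\<close>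

lemma overestimation_cases:
  assumes S: "S \<subseteq> I" and Z: "Z \<le> hypervolume r u S'" "S' \<subseteq> S" "Z \<le> hv_lip r"
  shows "Z - hypervolume r \<mu> S' \<le> hv_lip r * (\<Sum>i\<in>S. \<beta> i)"
proof -
  have fin: "finite S" using S finite_arms finite_subset by blast
  have b0: "0 \<le> \<beta> i" if "i \<in> S" for i using that S radius_nonneg by auto
  show ?thesis
  proof (cases "\<forall>i\<in>S'. \<beta> i \<le> 1")
    case True
    then have "Z - hypervolume r \<mu> S' \<le> hv_lip r * (\<Sum>i\<in>S'. \<beta> i)"
      using hypervolume_upper_le[of S'] S Z by fastforce
    also have "\<dots> \<le> hv_lip r * (\<Sum>i\<in>S. \<beta> i)"
      using hv_lip_pos[of r] Z(2) fin b0 by (intro mult_left_mono sum_mono2) auto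
    finally show ?thesis .
  next
    case False
    then obtain i where i: "i \<in> S" "1 < \<beta> i" using Z(2) by (auto simp: not_le)
    then have "1 \<le> (\<Sum>i\<in>S. \<beta> i)"
      using member_le_sum[of i S \<beta>] fin b0 by fastforce
    then have "hv_lip r * 1 \<le> hv_lip r * (\<Sum>i\<in>S. \<beta> i)"
      using hv_lip_pos[of r] by (intro mult_left_mono) auto
    moreover have "Z - hypervolume r \<mu> S' \<le> hv_lip r"
      using Z(3) hypervolume_nonneg[of r \<mu> S'] by linarith
    ultimately show ?thesis by linarith
  qed
qed

lemma greedy_upper_regret:
  assumes g: "greedy_seq (hypervolume r u) (active k) xs" and k: "length xs = k" "1 \<le> k"
    and B: "B \<subseteq> I" "card B = k"
  shows "(1 - 1 / exp 1) * hypervolume r \<mu> B - hypervolume r \<mu> (set xs)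
    \<le> hv_lip r * (\<Sum>i\<in>set xs. \<beta> i)"
proof -
  have a: "0 \<le> 1 - 1 / exp (1::real)" "1 - 1 / exp (1::real) \<le> 1" by auto
  have fin: "finite (active k)" using active_subset finite_arms finite_subset by blast
  obtain B' where B': "B' \<subseteq> active k" "card B' \<le> card B" "hypervolume r \<mu> B \<le> hypervolume r \<mu> B'"
    using dominated_by_active[OF B(1)] .
  have "hypervolume r \<mu> B \<le> hypervolume r u B'"
    using B' hypervolume_upper_ge[of B'] active_subset by fastforce
  then have "(1 - 1 / exp 1) * hypervolume r \<mu> B \<le> (1 - 1 / exp 1) * hypervolume r u B'"
    using a by (intro mult_left_mono)
  also have "\<dots> \<le> hypervolume r u (set xs)"
    using greedy_hypervolume[OF g k B'(1) fin] B' B by simp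
  finally have 1: "(1 - 1 / exp 1) * hypervolume r \<mu> B \<le> hypervolume r u (set xs)" .
  have "(1 - 1 / exp 1) * hypervolume r \<mu> B \<le> 1 * hypervolume r \<mu> B"
    using a by (intro mult_right_mono) auto
  also have "\<dots> \<le> hv_lip r" using hypervolume_mean_le[OF B(1)] by simp
  finally have 2: "(1 - 1 / exp 1) * hypervolume r \<mu> B \<le> hv_lip r" .
  have "set xs \<subseteq> I" using greedy_seq_subset[OF g] active_subset by blast
  from overestimation_cases[OF this 1 _ 2] show ?thesis by simp
qed

text \<open>Up to stage \<open>m\<close> both lists share the prefix \<open>P\<close>, so the value
  of \<open>P\<close> cancels in the gap. Being active, \<open>gs ! m\<close> competed with
  \<open>xs ! m\<close>; hence the true value of \<open>P\<close> with \<open>gs ! m\<close> is at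
  most the optimistic value of \<open>P\<close> with \<open>xs ! m\<close>, and the gap is at most
  the overestimation on a subset of the slate.\<close>

lemma first_deviation_gap:
  assumes g: "greedy_seq (hypervolume r u) (active k) xs" "length xs = k"
    and gs: "greedy_seq (hypervolume r \<mu>) I gs" "length gs = k" "set gs \<subseteq> active k"
    and neq: "xs \<noteq> gs"
  shows "\<exists>m<k. \<exists>i\<in>I - {gs ! m}. stage_gap (hypervolume r \<mu>) gs m i \<le> hv_lip r * (\<Sum>i\<in>set xs. \<beta> i)"
proof -
  define m where "m = (LEAST m. m < k \<and> xs ! m \<noteq> gs ! m)"
  have ex: "\<exists>m. m < k \<and> xs ! m \<noteq> gs ! m"
    using neq g(2) gs(2) by (auto simp: list_eq_iff_nth_eq)
  have m: "m < k" "xs ! m \<noteq> gs ! m"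
    using LeastI_ex[OF ex] by (auto simp: m_def)
  have before: "xs ! m' = gs ! m'" if "m' < m" for m'
    using not_less_Least[of m' "\<lambda>m. m < k \<and> xs ! m \<noteq> gs ! m"] that m by (auto simp: m_def)
  have pre: "take m xs = take m gs"
    using m g(2) gs(2) before by (intro nth_equalityI) auto
  let ?P = "set (take m gs)"
  have xsI: "set xs \<subseteq> I" using greedy_seq_subset[OF g(1)] active_subset by blast
  have gsI: "set gs \<subseteq> I" using greedy_seq_subset[OF gs(1)] .
  have PI: "?P \<subseteq> I" using gsI set_take_subset[of m gs] by blast
  have gm: "gs ! m \<in> active k - ?P"
    using greedy_seq_nth(1)[OF gs(1), of m] m gs by auto
  then have "marginal (hypervolume r u) ?P (gs ! m) \<le> marginal (hypervolume r u) ?P (xs ! m)"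
    using greedy_seq_nth(2)[OF g(1), of m] m g(2) pre by simp
  then have u: "hypervolume r u (insert (gs ! m) ?P) \<le> hypervolume r u (insert (xs ! m) ?P)"
    by (simp add: marginal_def)
  have gPI: "insert (gs ! m) ?P \<subseteq> I" using gm active_subset PI by auto
  have "hypervolume r \<mu> (insert (gs ! m) ?P) \<le> hypervolume r u (insert (xs ! m) ?P)"
    using hypervolume_upper_ge[OF gPI] u by linarith
  moreover have "insert (xs ! m) ?P \<subseteq> set xs"
    using m g(2) by (simp flip: pre add: set_take_subset)
  ultimately have "hypervolume r \<mu> (insert (gs ! m) ?P) - hypervolume r \<mu> (insert (xs ! m) ?P)
      \<le> hv_lip r * (\<Sum>i\<in>set xs. \<beta> i)"
    using overestimation_cases[OF xsI _ _ hypervolume_mean_le[OF gPI]] by blast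
  moreover have "xs ! m \<in> I - {gs ! m}" using m xsI g(2) by auto
  ultimately show ?thesis
    using m(1) by (intro exI[of _ m] conjI bexI[of _ "xs ! m"]) (auto simp: stage_gap_def marginal_def)
qed

end

section \<open>Concentration of the empirical means\<close>

lemma vec_nth_measurable [measurable]: "(\<lambda>x::real^'d. x $ j) \<in> borel_measurable borel"
  by (intro borel_measurable_continuous_onI continuous_intros)

lemma pulls_0 [simp]: "pulls S i 0 = 0"
  by (simp add: pulls_def)

lemma rounds_Suc:
  "{s \<in> {1..Suc t}. P s} = (if P (Suc t) then insert (Suc t) {s \<in> {1..t}. P s} else {s \<in> {1..t}. P s})"
  by (auto simp: le_Suc_eq)

lemma pulls_Suc: "pulls S i (Suc t) = pulls S i t + of_bool (i \<in> S (Suc t))"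
  unfolding pulls_def rounds_Suc by auto

lemma pulls_le: "pulls S i t \<le> t"
  by (induction t) (auto simp: pulls_Suc)

context thv_ucb_run
begin

lemma slate_measurable:
  assumes "s \<in> {1..T}" "s - 1 \<le> t"
  shows "S s \<in> measurable (F t) (count_space UNIV)"
proof -
  have "subalgebra (F t) (F (s - 1))"
    using sets_F_mono[OF assms(2)] by (auto simp: subalgebra_def space_F)
  then show ?thesis using slate_predictable[OF assms(1)] by (rule measurable_from_subalg)
qed

lemma played_measurable:
  assumes "s \<in> {1..T}" "s - 1 \<le> t"
  shows "Measurable.pred (F t) (\<lambda>\<omega>. i \<in> S s \<omega>)"
  using measurable_compose[OF slate_measurable[OF assms], of "\<lambda>A. i \<in> A" "count_space UNIV"] by simp

lemma reward_measurable: "i \<in> {1..n} \<Longrightarrow> s \<in> {1..T} \<Longrightarrow> X i s \<in> borel_measurable M"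
  using measurable_from_subalg[OF F_sub rewards_adapted[of i s s]] by simp

lemma reward_component_bounds:
  assumes "i \<in> {1..n}" "s \<in> {1..T}" "\<omega> \<in> space M"
  shows "0 \<le> X i s \<omega> $ j" "X i s \<omega> $ j \<le> 1"
  using rewards_bounded[OF assms] by (auto simp: mem_box_cart)

lemma mean_component:
  assumes "i \<in> {1..n}" "s \<in> {1..T}"
  shows "expectation (\<lambda>\<omega>. X i s \<omega> $ j) = \<mu> i $ j"
proof -
  have "norm (X i s \<omega>) \<le> (\<Sum>j\<in>(UNIV::'d set). 1)" if "\<omega> \<in> space M" for \<omega>
    using reward_component_bounds[OF assms that] by (intro order_trans[OF norm_le_l1_cart] sum_mono) auto
  then have "integrable M (X i s)"
    using reward_measurable[OF assms] by (intro integrable_const_bound[where B="\<Sum>j\<in>(UNIV::'d set). 1"]) auto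
  then show ?thesis
    using integral_bounded_linear[OF bounded_linear_vec_nth[of j]] rewards_mean[OF assms] by metis
qed

lemma mean_component_bounds:
  assumes "i \<in> {1..n}" "1 \<le> T"
  shows "0 \<le> \<mu> i $ j" "\<mu> i $ j \<le> 1"
proof -
  obtain s where 1: "s \<in> {1..T}" using assms by force
  note [measurable] = reward_measurable[OF assms(1) 1]
  have int: "integrable M (\<lambda>\<omega>. X i s \<omega> $ j)"
    using reward_component_bounds[OF assms(1) 1] by (intro integrable_const_bound[where B=1]) auto
  have "0 \<le> expectation (\<lambda>\<omega>. X i s \<omega> $ j)" "expectation (\<lambda>\<omega>. X i s \<omega> $ j) \<le> expectation (\<lambda>\<omega>. 1)"
    using reward_component_bounds[OF assms(1) 1] int
    by (auto intro!: integral_nonneg_AE integral_mono simp del: Bochner_Integration.lebesgue_integral_const)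
  then show "0 \<le> \<mu> i $ j" "\<mu> i $ j \<le> 1"
    using mean_component[OF assms(1) 1] by (auto simp: prob_space)
qed

lemma centered_reward_le:
  assumes "i \<in> {1..n}" "s \<in> {1..T}" "\<omega> \<in> space M"
  shows "\<bar>X i s \<omega> $ j - \<mu> i $ j\<bar> \<le> 1"
  using reward_component_bounds[OF assms, of j] mean_component_bounds[of i j] assms by fastforce

text \<open>This takes the place of conditioning on the past: \<open>Z\<close> and
  \<open>g (X i t)\<close> generate sub-\<sigma>-algebras of the two independent ones in
  \<open>rewards_fresh\<close>, so the expectation factorizes.\<close>

lemma expectation_mult_fresh:
  fixes Z :: "'a \<Rightarrow> real" and g :: "real^'d \<Rightarrow> real"
  assumes t: "t \<in> {1..T}" and i: "i \<in> {1..n}"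
    and Z: "Z \<in> borel_measurable (F (t - 1))" "integrable M Z"
    and g: "g \<in> borel_measurable borel" "integrable M (\<lambda>\<omega>. g (X i t \<omega>))"
  shows "expectation (\<lambda>\<omega>. Z \<omega> * g (X i t \<omega>)) = expectation Z * expectation (\<lambda>\<omega>. g (X i t \<omega>))"
    and "integrable M (\<lambda>\<omega>. Z \<omega> * g (X i t \<omega>))"
proof -
  let ?R = "\<lambda>\<omega>. \<lambda>i\<in>{1..n}. X i t \<omega>" and ?P = "PiM {1..n} (\<lambda>_. borel :: (real^'d) measure)"
  let ?V = "vimage_algebra (space M) ?R ?P"
  have "?R \<in> measurable ?V ?P"
    by (rule measurable_vimage_algebra1) (auto simp: space_PiM)
  then have "(\<lambda>\<omega>. ?R \<omega> i) \<in> borel_measurable ?V"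
    by (rule measurable_compose) (rule measurable_component_singleton[OF i])
  then have gV: "(\<lambda>\<omega>. g (X i t \<omega>)) \<in> borel_measurable ?V"
    using i g(1) measurable_compose by fastforce
  have sub: "sigma_sets (space M) {f -` A \<inter> space M |A. A \<in> sets borel} \<subseteq> sets N"
    if "f \<in> borel_measurable N" "space N = space M" for f :: "'a \<Rightarrow> real" and N :: "'a measure"
    using that measurable_sets[OF that(1)] unfolding that(2)[symmetric]
    by (intro sets.sigma_sets_subset) auto
  have "indep_set (sigma_sets (space M) {Z -` A \<inter> space M |A. A \<in> sets borel})
      (sigma_sets (space M) {(\<lambda>\<omega>. g (X i t \<omega>)) -` A \<inter> space M |A. A \<in> sets borel})"
    unfolding indep_set_def
    by (rule indep_sets_mono_sets[OF rewards_fresh[OF t, unfolded indep_set_def]])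
      (use sub[OF Z(1)] sub[OF gV] space_F in \<open>auto split: bool.split\<close>)
  then have ind: "indep_var borel Z borel (\<lambda>\<omega>. g (X i t \<omega>))"
    unfolding indep_var_eq using Z(2) g(2) by auto
  show "expectation (\<lambda>\<omega>. Z \<omega> * g (X i t \<omega>)) = expectation Z * expectation (\<lambda>\<omega>. g (X i t \<omega>))"
    by (rule indep_var_lebesgue_integral[OF ind Z(2) g(2)])
  show "integrable M (\<lambda>\<omega>. Z \<omega> * g (X i t \<omega>))"
    by (rule indep_var_integrable[OF ind Z(2) g(2)])
qed

section \<open>The exponential supermartingale of one arm and one coordinate\<close>

definition deviation :: "nat \<Rightarrow> 'd \<Rightarrow> nat \<Rightarrow> 'a \<Rightarrow> real" where
  "deviation i j t \<omega> = (\<Sum>s\<in>{1..t}. if i \<in> S s \<omega> then X i s \<omega> $ j - \<mu> i $ j else 0)"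

definition exp_weight :: "nat \<Rightarrow> 'd \<Rightarrow> real \<Rightarrow> nat \<Rightarrow> 'a \<Rightarrow> real" where
  "exp_weight i j c t \<omega> = exp (c * deviation i j t \<omega> - \<eta> * c\<^sup>2 / 2 * real (pulls (\<lambda>t. S t \<omega>) i t))"

lemma exp_weight_nonneg: "0 \<le> exp_weight i j c t \<omega>"
  by (simp add: exp_weight_def)

lemma exp_weight_Suc:
  "exp_weight i j c (Suc t) \<omega> = exp_weight i j c t \<omega> *
     (if i \<in> S (Suc t) \<omega> then exp (c * (X i (Suc t) \<omega> $ j - \<mu> i $ j) - \<eta> * c\<^sup>2 / 2) else 1)"
  by (simp add: exp_weight_def deviation_def pulls_Suc flip: exp_add) (simp add: algebra_simps)

lemma exp_weight_measurable:
  assumes i: "i \<in> {1..n}"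
  shows "t \<le> T \<Longrightarrow> exp_weight i j c t \<in> borel_measurable (F t)"
proof (induction t)
  case 0
  then show ?case by (simp add: exp_weight_def[abs_def] deviation_def)
next
  case (Suc t)
  have "subalgebra (F (Suc t)) (F t)"
    using sets_F_mono[of t "Suc t"] by (auto simp: subalgebra_def space_F)
  note [measurable] = measurable_from_subalg[OF this Suc.IH[OF Suc_leD[OF Suc.prems]]]
  have [measurable]: "X i (Suc t) \<in> borel_measurable (F (Suc t))"
    "Measurable.pred (F (Suc t)) (\<lambda>\<omega>. i \<in> S (Suc t) \<omega>)"
    using Suc.prems i by (auto intro!: rewards_adapted played_measurable)
  show ?case
    unfolding exp_weight_Suc[abs_def] by measurable
qed

lemma exp_weight_integrable:
  assumes i: "i \<in> {1..n}" and t: "t \<le> T"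
  shows "integrable M (exp_weight i j c t)"
proof (rule integrable_const_bound[where B="exp (\<bar>c\<bar> * real t)"])
  show "exp_weight i j c t \<in> borel_measurable M"
    by (rule measurable_from_subalg[OF F_sub exp_weight_measurable[OF i t]])
  have "norm (exp_weight i j c t \<omega>) \<le> exp (\<bar>c\<bar> * real t)" if \<omega>: "\<omega> \<in> space M" for \<omega>
  proof -
    have "\<bar>deviation i j t \<omega>\<bar> \<le> (\<Sum>s\<in>{1..t}. 1)"
      unfolding deviation_def using centered_reward_le[OF i _ \<omega>] t
      by (intro order_trans[OF sum_abs] sum_mono) auto
    then have "c * deviation i j t \<omega> \<le> \<bar>c\<bar> * real t"
      using mult_left_mono[of "\<bar>deviation i j t \<omega>\<bar>" "real t" "\<bar>c\<bar>"] abs_ge_self[of "c * deviation i j t \<omega>"]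
      by (simp add: abs_mult)
    moreover have "0 \<le> \<eta> * c\<^sup>2 / 2 * real (pulls (\<lambda>t. S t \<omega>) i t)" using \<eta>_pos by simp
    ultimately show ?thesis unfolding exp_weight_def by simp
  qed
  then show "AE \<omega> in M. norm (exp_weight i j c t \<omega>) \<le> exp (\<bar>c\<bar> * real t)" by simp
qed

text \<open>The weight is split into its part \<open>?Y\<close> on the event that the arm is played
  next and its part \<open>?Z\<close> on the complement. Both are known after round
  \<open>t\<close>, since the slate is predictable; only \<open>?Y\<close> acquires a fresh factor,
  whose mean is at most 1 by sub-Gaussianity.\<close>

lemma expectation_exp_weight_le_1:
  assumes i: "i \<in> {1..n}"
  shows "t \<le> T \<Longrightarrow> expectation (exp_weight i j c t) \<le> 1"
proof (induction t)
  case 0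
  then show ?case by (simp add: exp_weight_def[abs_def] deviation_def prob_space)
next
  case (Suc t)
  let ?W = "exp_weight i j c t"
  let ?Y = "\<lambda>\<omega>. ?W \<omega> * of_bool (i \<in> S (Suc t) \<omega>)" and ?Z = "\<lambda>\<omega>. ?W \<omega> * of_bool (i \<notin> S (Suc t) \<omega>)"
  let ?g = "\<lambda>x::real^'d. exp (c * (x $ j - \<mu> i $ j) - \<eta> * c\<^sup>2 / 2)"
  have t: "Suc t \<in> {1..T}" "t \<le> T" using Suc.prems by auto
  note [measurable] = exp_weight_measurable[OF i t(2)] played_measurable[OF t(1), of t i]
  have W1F: "?Y \<in> borel_measurable (F (Suc t - 1))" and W0F: "?Z \<in> borel_measurable (F t)"
    by (simp, measurable)
  have int: "integrable M ?Y" "integrable M ?Z"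
    using measurable_from_subalg[OF F_sub W1F] measurable_from_subalg[OF F_sub W0F]
    by (auto intro!: Bochner_Integration.integrable_bound[OF exp_weight_integrable[OF i t(2), of j c]])
  have g: "?g \<in> borel_measurable borel" by measurable
  note [measurable] = reward_measurable[OF i t(1)]
  have gint: "integrable M (\<lambda>\<omega>. exp (c * (X i (Suc t) \<omega> $ j - \<mu> i $ j)))"
  proof (rule integrable_const_bound[where B="exp \<bar>c\<bar>"])
    have "c * (X i (Suc t) \<omega> $ j - \<mu> i $ j) \<le> \<bar>c\<bar>" if "\<omega> \<in> space M" for \<omega>
      using mult_left_mono[OF centered_reward_le[OF i t(1) that, of j], of "\<bar>c\<bar>"]
        abs_ge_self[of "c * (X i (Suc t) \<omega> $ j - \<mu> i $ j)"] by (simp add: abs_mult)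
    then show "AE \<omega> in M. norm (exp (c * (X i (Suc t) \<omega> $ j - \<mu> i $ j))) \<le> exp \<bar>c\<bar>" by simp
  qed measurable
  have gX: "(\<lambda>\<omega>. ?g (X i (Suc t) \<omega>)) = (\<lambda>\<omega>. exp (c * (X i (Suc t) \<omega> $ j - \<mu> i $ j)) * exp (- (\<eta> * c\<^sup>2 / 2)))"
    by (simp flip: exp_add)
  have gint': "integrable M (\<lambda>\<omega>. ?g (X i (Suc t) \<omega>))"
    unfolding gX using gint by simp
  have "expectation (\<lambda>\<omega>. ?g (X i (Suc t) \<omega>))
      = expectation (\<lambda>\<omega>. exp (c * (X i (Suc t) \<omega> $ j - \<mu> i $ j))) * exp (- (\<eta> * c\<^sup>2 / 2))"
    unfolding gX by simp
  also have "\<dots> \<le> exp (\<eta> * c\<^sup>2 / 2) * exp (- (\<eta> * c\<^sup>2 / 2))"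
    using rewards_subgaussian[OF i t(1), of c j] by (intro mult_right_mono) auto
  finally have g1: "expectation (\<lambda>\<omega>. ?g (X i (Suc t) \<omega>)) \<le> 1" by (simp flip: exp_add)
  note prod = expectation_mult_fresh[OF t(1) i W1F int(1) g gint']
  have "expectation (exp_weight i j c (Suc t)) = expectation (\<lambda>\<omega>. ?Y \<omega> * ?g (X i (Suc t) \<omega>) + ?Z \<omega>)"
    by (rule Bochner_Integration.integral_cong) (auto simp: exp_weight_Suc)
  also have "\<dots> = expectation ?Y * expectation (\<lambda>\<omega>. ?g (X i (Suc t) \<omega>)) + expectation ?Z"
    using prod int by simp
  also have "\<dots> \<le> expectation ?Y * 1 + expectation ?Z"
    using g1 by (intro add_right_mono mult_left_mono integral_nonneg) (auto simp: exp_weight_def)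
  also have "\<dots> = expectation (\<lambda>\<omega>. ?Y \<omega> + ?Z \<omega>)"
    using int by simp
  also have "\<dots> = expectation ?W"
    by (rule Bochner_Integration.integral_cong) auto
  finally show ?case using Suc by simp
qed

lemma emp_mean_deviation:
  assumes "1 \<le> pulls (\<lambda>t. S t \<omega>) i t"
  shows "emp_mean (\<lambda>t. S t \<omega>) (\<lambda>i t. X i t \<omega>) i t $ j - \<mu> i $ j
    = deviation i j t \<omega> / real (pulls (\<lambda>t. S t \<omega>) i t)"
proof -
  let ?R = "{s \<in> {1..t}. i \<in> S s \<omega>}"
  have "deviation i j t \<omega> = (\<Sum>s\<in>?R. X i s \<omega> $ j - \<mu> i $ j)"
    unfolding deviation_def by (rule sum.inter_filter[symmetric]) simp
  also have "\<dots> = (\<Sum>s\<in>?R. X i s \<omega> $ j) - real (pulls (\<lambda>t. S t \<omega>) i t) * \<mu> i $ j"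
    by (simp add: sum_subtractf pulls_def)
  finally show ?thesis
    using assms by (simp add: emp_mean_def field_simps)
qed

section \<open>Confidence radii and the failure event of one round\<close>

definition log_level :: "nat \<Rightarrow> real" where
  "log_level t = ln (real n * real CARD('d) * (real t)\<^sup>2 / \<delta>)"

text \<open>The inequality is strict because \<open>\<delta> < 1\<close>. It makes every radius
  positive, and thereby each lower bound strictly smaller than the upper one.\<close>

lemma log_level_arg_gt_1:
  assumes "1 \<le> t"
  shows "1 < real n * real CARD('d) * (real t)\<^sup>2 / \<delta>"
proof -
  have "1 \<le> n * CARD('d) * t\<^sup>2"
    using k_pos k_le assms by (simp add: Suc_leI)
  then have "1 \<le> real n * real CARD('d) * (real t)\<^sup>2"
    by (metis of_nat_mult of_nat_power of_nat_1 of_nat_le_iff)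
  then show ?thesis using \<delta>_pos \<delta>_less by (simp add: field_simps)
qed

lemma log_level_pos: "1 \<le> t \<Longrightarrow> 0 < log_level t"
  unfolding log_level_def by (intro ln_gt_zero log_level_arg_gt_1)

lemma exp_log_level: "1 \<le> t \<Longrightarrow> exp (log_level t) = real n * real CARD('d) * (real t)\<^sup>2 / \<delta>"
  using log_level_arg_gt_1[of t] by (simp add: log_level_def)

abbreviation num_pulls :: "'a \<Rightarrow> nat \<Rightarrow> nat \<Rightarrow> nat" where
  "num_pulls \<omega> \<equiv> pulls (\<lambda>t. S t \<omega>)"

definition radius :: "'a \<Rightarrow> nat \<Rightarrow> nat \<Rightarrow> real" where
  "radius \<omega> i t = sqrt (2 * \<eta> * log_level t / max 1 (real (num_pulls \<omega> i (t - 1))))"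

abbreviation estimate :: "'a \<Rightarrow> nat \<Rightarrow> nat \<Rightarrow> real^'d" where
  "estimate \<omega> \<equiv> emp_mean (\<lambda>t. S t \<omega>) (\<lambda>i t. X i t \<omega>)"

lemma conf_radius_eq: "conf_radius n CARD('d) \<eta> \<delta> (\<lambda>t. S t \<omega>) = radius \<omega>"
  by (intro ext) (simp add: conf_radius_def radius_def log_level_def)

text \<open>With \<open>m\<close> pulls and radius \<open>\<epsilon>\<close> the tilt is \<open>c = \<plusminus> \<epsilon> / \<eta>\<close>. The number of pulls is random, so
  the exceptional event is a union over all its possible values.\<close>

lemma exceptional_event:
  assumes t: "t \<in> {1..T}"
  shows "\<exists>E\<in>events. prob E \<le> 2 * \<delta> \<and> (\<forall>\<omega>\<in>space M - E. \<forall>i\<in>{1..n}. \<forall>j.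
    1 \<le> num_pulls \<omega> i (t - 1) \<longrightarrow> \<bar>estimate \<omega> i (t - 1) $ j - \<mu> i $ j\<bar> \<le> radius \<omega> i t)"
proof -
  have t1: "1 \<le> t" "t - 1 \<le> T" using t by auto
  define \<epsilon> where "\<epsilon> m = sqrt (2 * \<eta> * log_level t / real m)" for m :: nat
  \<comment> \<open>One event per arm, coordinate, possible pull count below \<open>t\<close> and
    sign of the error. With \<open>d\<close> coordinates there are
    \<open>2 * n * d * (t - 1)\<close> of them; the \<open>t\<^sup>2\<close> in the confidence level
    pays for the pull counts.\<close>
  define J where "J = {1..n} \<times> (UNIV :: 'd set) \<times> {1..<t} \<times> {1, - 1 :: real}"
  define E where "E = (\<lambda>(i, j, m, \<sigma>). {\<omega> \<in> space M. exp (log_level t) \<le> exp_weight i j (\<sigma> * \<epsilon> m / \<eta>) (t - 1) \<omega>})"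
  have meas: "E x \<in> events" and le: "prob (E x) \<le> \<delta> / (real n * real CARD('d) * (real t)\<^sup>2)" if "x \<in> J" for x
  proof -
    obtain i j m \<sigma> where x: "x = (i, j, m, \<sigma>)" "i \<in> {1..n}" using \<open>x \<in> J\<close> unfolding J_def by blast
    have [measurable]: "exp_weight i j (\<sigma> * \<epsilon> m / \<eta>) (t - 1) \<in> borel_measurable M"
      using exp_weight_integrable[OF x(2) t1(2)] by blast
    show "E x \<in> events" unfolding E_def x by (simp del: One_nat_def)
    have "prob (E x) \<le> expectation (exp_weight i j (\<sigma> * \<epsilon> m / \<eta>) (t - 1)) / exp (log_level t)"
      unfolding E_def x prod.case using exp_weight_integrable[OF x(2) t1(2)]
      by (intro integral_Markov_inequality_measure[where A="{}"])
        (auto simp: exp_weight_nonneg simp del: One_nat_def)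
    also have "\<dots> \<le> 1 / exp (log_level t)"
      using expectation_exp_weight_le_1[OF x(2) t1(2)] by (intro divide_right_mono) auto
    finally show "prob (E x) \<le> \<delta> / (real n * real CARD('d) * (real t)\<^sup>2)"
      using t1 by (simp add: exp_log_level)
  qed
  have fin: "finite J" by (simp add: J_def)
  have "prob (\<Union>x\<in>J. E x) \<le> (\<Sum>x\<in>J. prob (E x))"
    using meas fin by (intro finite_measure_subadditive_finite) auto
  also have "\<dots> \<le> real (card J) * (\<delta> / (real n * real CARD('d) * (real t)\<^sup>2))"
    by (rule sum_bounded_above) (rule le)
  also have "real (card J) = real n * real CARD('d) * real (t - 1) * 2"
    by (simp add: J_def card_cartesian_product)
  also have "\<dots> * (\<delta> / (real n * real CARD('d) * (real t)\<^sup>2)) = 2 * \<delta> * (real (t - 1) / (real t)\<^sup>2)"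
    using k_pos k_le by (simp add: field_simps)
  also have "\<dots> \<le> 2 * \<delta> * 1"
  proof (intro mult_left_mono)
    have "real (t - 1) \<le> 1 * real t" by simp
    also have "\<dots> \<le> real t * real t" using t1 by (intro mult_right_mono) auto
    finally show "real (t - 1) / (real t)\<^sup>2 \<le> 1" using t1 by (simp add: power2_eq_square field_simps)
  qed (use \<delta>_pos in auto)
  finally have "prob (\<Union>x\<in>J. E x) \<le> 2 * \<delta>" by simp
  moreover have "\<bar>estimate \<omega> i (t - 1) $ j - \<mu> i $ j\<bar> \<le> radius \<omega> i t"
    if \<omega>: "\<omega> \<in> space M - (\<Union>x\<in>J. E x)" and i: "i \<in> {1..n}" and p: "1 \<le> num_pulls \<omega> i (t - 1)" for \<omega> i j
  proof (rule ccontr)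
    assume "\<not> ?thesis"
    define m where "m = num_pulls \<omega> i (t - 1)"
    define D where "D = deviation i j (t - 1) \<omega>"
    define \<sigma> :: real where "\<sigma> = (if 0 \<le> D then 1 else - 1)"
    have m: "1 \<le> m" "m \<le> t - 1" using p pulls_le[of "\<lambda>t. S t \<omega>" i "t - 1"] by (auto simp: m_def)
    have e0: "0 < \<epsilon> m" "(\<epsilon> m)\<^sup>2 = 2 * \<eta> * log_level t / real m"
      using m \<eta>_pos log_level_pos[OF t1(1)] by (auto simp: \<epsilon>_def)
    have "radius \<omega> i t = \<epsilon> m" using p by (simp add: radius_def \<epsilon>_def m_def max_def)
    with \<open>\<not> ?thesis\<close> have "\<epsilon> m < \<bar>D\<bar> / real m"
      using emp_mean_deviation[OF p, of j] m by (simp add: m_def D_def)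
    then have "\<epsilon> m * real m \<le> \<bar>D\<bar>" using m by (simp add: field_simps)
    \<comment> \<open>At this tilt the linear term is at least twice the log level and the
      compensator is exactly the log level, so their difference reaches the threshold in
      \<open>E\<close>.\<close>
    then have "\<epsilon> m / \<eta> * (\<epsilon> m * real m) \<le> \<epsilon> m / \<eta> * \<bar>D\<bar>"
      using e0 \<eta>_pos by (intro mult_left_mono) auto
    moreover have "\<epsilon> m / \<eta> * (\<epsilon> m * real m) = 2 * log_level t"
      using e0(2) m \<eta>_pos by (simp add: power2_eq_square field_simps)
    moreover have "\<sigma> * \<epsilon> m / \<eta> * D = \<epsilon> m / \<eta> * \<bar>D\<bar>" by (simp add: \<sigma>_def)
    moreover have "\<eta> * (\<sigma> * \<epsilon> m / \<eta>)\<^sup>2 / 2 * real m = log_level t"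
    proof -
      have "(\<sigma> * \<epsilon> m / \<eta>)\<^sup>2 = (\<epsilon> m)\<^sup>2 / \<eta>\<^sup>2" by (simp add: \<sigma>_def power_divide)
      then have "\<eta> * (\<sigma> * \<epsilon> m / \<eta>)\<^sup>2 / 2 * real m = \<eta> * (2 * \<eta> * log_level t / real m / \<eta>\<^sup>2) / 2 * real m"
        by (simp only: e0(2))
      then show ?thesis using m \<eta>_pos by (simp add: power2_eq_square)
    qed
    ultimately have "log_level t \<le> \<sigma> * \<epsilon> m / \<eta> * D - \<eta> * (\<sigma> * \<epsilon> m / \<eta>)\<^sup>2 / 2 * real m" by linarith
    then have "\<omega> \<in> E (i, j, m, \<sigma>)" using \<omega> by (simp add: E_def exp_weight_def m_def D_def)
    moreover have "(i, j, m, \<sigma>) \<in> J" using i m by (auto simp: J_def \<sigma>_def)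
    ultimately show False using \<omega> by blast
  qed
  ultimately show ?thesis using meas fin by (intro bexI[of _ "\<Union>x\<in>J. E x"]) auto
qed

end

section \<open>Sums over pulls\<close>

text \<open>A telescoping bound: \<open>sqrt (N + 1) - sqrt N\<close> is the inverse of the sum of
  the two roots, and that sum is at most \<open>3 * sqrt N\<close> for positive \<open>N\<close>,
  whence the constant.\<close>

lemma sum_inverse_sqrt_le: "(\<Sum>m<N. 1 / sqrt (max 1 (real m))) \<le> 3 * sqrt (real N)"
proof (induction N)
  case (Suc N)
  have "1 / sqrt (max 1 (real N)) \<le> 3 * (sqrt (real (Suc N)) - sqrt (real N))"
  proof (cases "N = 0")
    case False
    let ?a = "sqrt (real N)" and ?b = "sqrt (real (Suc N))"
    have a: "0 < ?a" using False by simp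
    have b: "?b \<le> 2 * ?a"
      using False by (intro real_le_lsqrt) (auto simp: power_mult_distrib)
    have "?b * ?b - ?a * ?a = 1" by simp
    then have "(?b - ?a) * (?b + ?a) = 1" by (simp add: algebra_simps)
    moreover have "(?b - ?a) * (?b + ?a) \<le> (?b - ?a) * (3 * ?a)"
      using b by (intro mult_left_mono) auto
    ultimately have "1 \<le> 3 * (?b - ?a) * ?a" by (simp add: mult_ac)
    then show ?thesis using False a by (simp add: max_def field_simps)
  qed simp
  with Suc show ?case by simp
qed simp

text \<open>The terms decrease, so the surviving ones form an initial segment.\<close>

lemma sum_truncated_inverse_sqrt_le:
  assumes "0 \<le> a" "0 < c"
  shows "(\<Sum>m<N. if c < a / sqrt (max 1 (real m)) then a / sqrt (max 1 (real m)) else 0) \<le> 5 * a\<^sup>2 / c"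
proof (induction N)
  case 0
  then show ?case using assms by simp
next
  case (Suc N)
  let ?h = "\<lambda>m. a / sqrt (max 1 (real m))"
  show ?case
  proof (cases "c < ?h N")
    case True
    let ?s = "sqrt (max 1 (real N))"
    have s: "0 < ?s" by simp
    have "(\<Sum>m<Suc N. if c < ?h m then ?h m else 0) \<le> (\<Sum>m<Suc N. ?h m)"
      using assms by (intro sum_mono) auto
    also have "\<dots> = a * (\<Sum>m<Suc N. 1 / sqrt (max 1 (real m)))"
      by (simp only: sum_distrib_left) simp
    also have "\<dots> \<le> a * (3 * sqrt (real (Suc N)))"
      using assms by (intro mult_left_mono sum_inverse_sqrt_le)
    \<comment> \<open>The ratio of \<open>sqrt (N + 1)\<close> to \<open>?s\<close> is at most
      \<open>sqrt 2\<close>, hence below 3/2, and 9/2 is rounded up to 5. Survival of term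
      \<open>N\<close> then bounds \<open>?s\<close> by \<open>a / c\<close>.\<close>
    also have "\<dots> \<le> a * (3 * (3 / 2 * ?s))"
      using assms
      by (intro mult_left_mono real_le_lsqrt) (auto simp: power_mult_distrib power_divide)
    also have "\<dots> \<le> 5 * (a * ?s)"
      using mult_nonneg_nonneg[of a ?s] assms by simp
    also have "\<dots> \<le> 5 * (a\<^sup>2 / c)"
    proof -
      have "c * ?s \<le> a" using True s by (simp add: field_simps)
      then have "a * (c * ?s) \<le> a * a" using assms by (intro mult_left_mono)
      then show ?thesis using assms by (simp add: field_simps power2_eq_square)
    qed
    finally show ?thesis by (simp del: sum.lessThan_Suc)
  next
    case False
    then show ?thesis using Suc by simp
  qed
qed

lemma sum_sqrt_le:
  assumes "finite I" "\<And>i. i \<in> I \<Longrightarrow> 0 \<le> f i"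
  shows "(\<Sum>i\<in>I. sqrt (f i)) \<le> sqrt (real (card I) * (\<Sum>i\<in>I. f i))"
proof (rule real_le_rsqrt)
  have "(\<Sum>i\<in>I. 1 * sqrt (f i))\<^sup>2 \<le> (\<Sum>i\<in>I. 1\<^sup>2) * (\<Sum>i\<in>I. (sqrt (f i))\<^sup>2)"
    by (rule Cauchy_Schwarz_ineq_sum)
  also have "(\<Sum>i\<in>I. (sqrt (f i))\<^sup>2) = (\<Sum>i\<in>I. f i)"
    using assms by (intro sum.cong) auto
  finally show "(\<Sum>i\<in>I. sqrt (f i))\<^sup>2 \<le> real (card I) * (\<Sum>i\<in>I. f i)" by simp
qed

text \<open>Each time an arm is played its previous pull count takes the next value 0, 1, 2, ..., so
  a charge depending only on that count can be summed arm by arm.\<close>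

lemma sum_over_pulls:
  fixes g :: "nat \<Rightarrow> real"
  assumes "finite I" "\<And>t. t \<in> {1..T} \<Longrightarrow> S t \<subseteq> I"
  shows "(\<Sum>t\<in>{1..T}. \<Sum>i\<in>S t. g (pulls S i (t - 1))) = (\<Sum>i\<in>I. \<Sum>m<pulls S i T. g m)"
proof -
  have one: "(\<Sum>t\<in>{1..T}. if i \<in> S t then g (pulls S i (t - 1)) else 0) = (\<Sum>m<pulls S i T. g m)" for i
    by (induction T) (auto simp: pulls_Suc)
  have "(\<Sum>i\<in>S t. g (pulls S i (t - 1))) = (\<Sum>i\<in>I. if i \<in> S t then g (pulls S i (t - 1)) else 0)"
    if "t \<in> {1..T}" for t
    using assms that by (simp add: sum.If_cases Int_absorb1)
  then have "(\<Sum>t\<in>{1..T}. \<Sum>i\<in>S t. g (pulls S i (t - 1)))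
      = (\<Sum>t\<in>{1..T}. \<Sum>i\<in>I. if i \<in> S t then g (pulls S i (t - 1)) else 0)"
    by (rule sum.cong[OF refl])
  also have "\<dots> = (\<Sum>i\<in>I. \<Sum>t\<in>{1..T}. if i \<in> S t then g (pulls S i (t - 1)) else 0)"
    by (rule sum.swap)
  finally show ?thesis by (simp only: one)
qed

section \<open>Expected regret\<close>

context thv_ucb_run
begin

abbreviation initializing :: "'a \<Rightarrow> nat \<Rightarrow> bool" where
  "initializing \<omega> \<equiv> init_round n m0 (\<lambda>t. S t \<omega>)"

abbreviation active_at :: "'a \<Rightarrow> nat \<Rightarrow> nat set" where
  "active_at \<omega> \<equiv> active_arms n k \<eta> \<delta> (\<lambda>t. S t \<omega>) (\<lambda>i t. X i t \<omega>)"

abbreviation ucb_at :: "'a \<Rightarrow> nat \<Rightarrow> nat \<Rightarrow> real^'d" where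
  "ucb_at \<omega> \<equiv> ucb n \<eta> \<delta> (\<lambda>t. S t \<omega>) (\<lambda>i t. X i t \<omega>)"

abbreviation lcb_at :: "'a \<Rightarrow> nat \<Rightarrow> nat \<Rightarrow> real^'d" where
  "lcb_at \<omega> \<equiv> lcb n \<eta> \<delta> (\<lambda>t. S t \<omega>) (\<lambda>i t. X i t \<omega>)"

text \<open>Arms without pulls are left out because their estimate is the default 0. After
  initialization every arm has a pull, since \<open>1 \<le> m0\<close>.\<close>

definition concentrated :: "'a \<Rightarrow> nat \<Rightarrow> bool" where
  "concentrated \<omega> t \<longleftrightarrow> (\<forall>i\<in>{1..n}. \<forall>j. 1 \<le> num_pulls \<omega> i (t - 1) \<longrightarrow>
     \<bar>estimate \<omega> i (t - 1) $ j - \<mu> i $ j\<bar> \<le> radius \<omega> i t)"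

definition regret :: "nat \<Rightarrow> 'a \<Rightarrow> real" where
  "regret t \<omega> = (1 - 1 / exp 1) * opt_value n k r \<mu> - hypervolume r \<mu> (S t \<omega>)"

lemma active_at_subset: "active_at \<omega> t \<subseteq> {1..n}"
  by (auto simp: active_arms_def unpruned_def)

lemma round_played:
  assumes "t \<in> {1..T}" "\<omega> \<in> space M"
  shows "if initializing \<omega> t then least_pulled n k (\<lambda>t. S t \<omega>) t
    else \<exists>xs. length xs = k \<and> greedy_seq (hypervolume r (ucb_at \<omega> t)) (active_at \<omega> t) xs \<and> S t \<omega> = set xs"
  using follows_algorithm[OF assms(2)] assms(1) unfolding thv_ucb_path_def by (rule bspec)

lemma main_round_greedy:
  assumes "t \<in> {1..T}" "\<omega> \<in> space M" "\<not> initializing \<omega> t"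
  obtains xs where "length xs = k" "greedy_seq (hypervolume r (ucb_at \<omega> t)) (active_at \<omega> t) xs" "S t \<omega> = set xs"
  using round_played[OF assms(1,2)] assms(3) by auto

lemma slate:
  assumes "t \<in> {1..T}" "\<omega> \<in> space M"
  shows slate_subset: "S t \<omega> \<subseteq> {1..n}" and card_slate: "card (S t \<omega>) = k"
proof -
  have "S t \<omega> \<subseteq> {1..n} \<and> card (S t \<omega>) = k"
  proof (cases "initializing \<omega> t")
    case True
    then show ?thesis
      using round_played[OF assms] by (auto simp: least_pulled_def)
  next
    case False
    then obtain xs where xs: "length xs = k" "S t \<omega> = set xs"
      and g: "greedy_seq (hypervolume r (ucb_at \<omega> t)) (active_at \<omega> t) xs"
      using main_round_greedy[OF assms] by blast
    have "set xs \<subseteq> {1..n}" using greedy_seq_subset[OF g] active_at_subset by (rule order_trans)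
    then show ?thesis using xs distinct_card[OF greedy_seq_distinct[OF g]] by simp
  qed
  then show "S t \<omega> \<subseteq> {1..n}" "card (S t \<omega>) = k" by auto
qed

lemma mean_le_1: "1 \<le> T \<Longrightarrow> i \<in> {1..n} \<Longrightarrow> \<mu> i \<le> 1"
  using mean_component_bounds(2) by (simp add: less_eq_vec_def)

lemma hypervolume_mean_le: "1 \<le> T \<Longrightarrow> B \<subseteq> {1..n} \<Longrightarrow> hypervolume r \<mu> B \<le> hv_lip r"
  using mean_le_1 finite_subset[of B "{1..n}"] by (intro hypervolume_le_hv_lip) auto

lemma optimal_slate:
  obtains B where "B \<subseteq> {1..n}" "card B = k" "opt_value n k r \<mu> = hypervolume r \<mu> B"
proof -
  let ?F = "{B. B \<subseteq> {1..n} \<and> card B = k}"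
  have "{1..k} \<in> ?F" using k_le by simp
  then have "hypervolume r \<mu> ` ?F \<noteq> {}" by blast
  moreover have "finite ?F"
    by (rule finite_subset[of _ "Pow {1..n}"]) auto
  ultimately have "opt_value n k r \<mu> \<in> hypervolume r \<mu> ` ?F"
    unfolding opt_value_def by (intro Max_in finite_imageI)
  then obtain B where "opt_value n k r \<mu> = hypervolume r \<mu> B" "B \<in> ?F" by (rule imageE)
  then show ?thesis by (intro that[of B]) auto
qed

lemma regret_le:
  assumes "1 \<le> T"
  shows "regret t \<omega> \<le> hv_lip r"
proof -
  obtain B where "B \<subseteq> {1..n}" "opt_value n k r \<mu> = hypervolume r \<mu> B"
    using optimal_slate by blast
  then have "0 \<le> opt_value n k r \<mu>" "opt_value n k r \<mu> \<le> hv_lip r"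
    using hypervolume_mean_le[OF assms] by auto
  moreover have "(1 - 1 / exp 1) * opt_value n k r \<mu> \<le> 1 * opt_value n k r \<mu>"
    using calculation by (intro mult_right_mono) auto
  ultimately show ?thesis
    using hypervolume_nonneg[of r \<mu> "S t \<omega>"] unfolding regret_def by linarith
qed

lemma radius_pos: "1 \<le> t \<Longrightarrow> 0 < radius \<omega> i t"
  using log_level_pos[of t] \<eta>_pos by (simp add: radius_def)

section \<open>Regret of a single round\<close>

lemma main_round_confidence_bounds:
  assumes t: "t \<in> {1..T}" and main: "\<not> initializing \<omega> t" and conc: "concentrated \<omega> t"
  shows "confidence_bounds {1..n} r \<mu> (ucb_at \<omega> t) (lcb_at \<omega> t) (\<lambda>i. radius \<omega> i t)"
proof -
  have c: "\<bar>estimate \<omega> i (t - 1) $ j - \<mu> i $ j\<bar> \<le> radius \<omega> i t" if "i \<in> {1..n}" for i j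
  proof -
    have "1 \<le> num_pulls \<omega> i (t - 1)"
      using main that m0_pos unfolding init_round_def by force
    then show ?thesis using conc that by (simp add: concentrated_def)
  qed
  show ?thesis
  proof
    fix i assume i: "i \<in> {1..n}"
    show "r \<le> \<mu> i" by (rule ref_point[OF i])
    show "\<mu> i \<le> 1" using mean_le_1[OF _ i] t by simp
    show "lcb_at \<omega> t i \<le> \<mu> i" "\<mu> i \<le> ucb_at \<omega> t i" "ucb_at \<omega> t i \<le> \<mu> i + vec (2 * radius \<omega> i t)"
      using c[OF i] unfolding less_eq_vec_def lcb_def ucb_def conf_radius_eq
      by (auto simp: abs_le_iff algebra_simps dest!: meta_spec)
    show "lcb_at \<omega> t i $ j < ucb_at \<omega> t i $ j" for j
      using radius_pos[of t \<omega> i] t unfolding lcb_def ucb_def conf_radius_eq by simp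
  qed simp
qed

lemma active_at_eq:
  assumes "confidence_bounds {1..n} r \<mu> (ucb_at \<omega> t) (lcb_at \<omega> t) (\<lambda>i. radius \<omega> i t)"
  shows "active_at \<omega> t = confidence_bounds.active {1..n} (ucb_at \<omega> t) (lcb_at \<omega> t) k"
  unfolding active_arms_def unpruned_def confidence_bounds.active_def[OF assms]
    confidence_bounds.survivors_def[OF assms] by (rule refl)

lemma main_round_regret_le:
  assumes t: "t \<in> {1..T}" and \<omega>: "\<omega> \<in> space M" and main: "\<not> initializing \<omega> t" and conc: "concentrated \<omega> t"
  shows "regret t \<omega> \<le> hv_lip r * (\<Sum>i\<in>S t \<omega>. radius \<omega> i t)"
proof -
  interpret cb: confidence_bounds "{1..n}" r \<mu> "ucb_at \<omega> t" "lcb_at \<omega> t" "\<lambda>i. radius \<omega> i t"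
    by (rule main_round_confidence_bounds[OF t main conc])
  obtain xs where xs: "length xs = k" "greedy_seq (hypervolume r (ucb_at \<omega> t)) (active_at \<omega> t) xs" "S t \<omega> = set xs"
    by (rule main_round_greedy[OF t \<omega> main])
  note g = xs(2)[unfolded active_at_eq[OF cb.confidence_bounds_axioms]]
  obtain B where "B \<subseteq> {1..n}" "card B = k" "opt_value n k r \<mu> = hypervolume r \<mu> B"
    by (rule optimal_slate)
  then show ?thesis
    using cb.greedy_upper_regret[OF g xs(1) k_pos] xs(3) by (simp add: regret_def)
qed

text \<open>If the picks reproduce \<open>gs\<close>, the slate is greedy for the true means, so the
  factor 1 - 1/e makes its regret nonpositive. Otherwise the first deviation supplies the
  gap.\<close>

lemma main_round_gap:
  assumes t: "t \<in> {1..T}" and \<omega>: "\<omega> \<in> space M" and main: "\<not> initializing \<omega> t" and conc: "concentrated \<omega> t"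
    and gs: "length gs = k" "greedy_seq (hypervolume r \<mu>) {1..n} gs" "set gs \<subseteq> active_at \<omega> t"
  shows "regret t \<omega> \<le> 0 \<or> (\<exists>m<k. \<exists>i\<in>{1..n} - {gs ! m}.
    stage_gap (hypervolume r \<mu>) gs m i \<le> hv_lip r * (\<Sum>i\<in>S t \<omega>. radius \<omega> i t))"
proof -
  interpret cb: confidence_bounds "{1..n}" r \<mu> "ucb_at \<omega> t" "lcb_at \<omega> t" "\<lambda>i. radius \<omega> i t"
    by (rule main_round_confidence_bounds[OF t main conc])
  note act = active_at_eq[OF cb.confidence_bounds_axioms]
  obtain xs where xs: "length xs = k" "greedy_seq (hypervolume r (ucb_at \<omega> t)) (active_at \<omega> t) xs" "S t \<omega> = set xs"
    by (rule main_round_greedy[OF t \<omega> main])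
  note g = xs(2)[unfolded act]
  show ?thesis
  proof (cases "xs = gs")
    case True
    obtain B where "B \<subseteq> {1..n}" "card B = k" "opt_value n k r \<mu> = hypervolume r \<mu> B"
      by (rule optimal_slate)
    then have "regret t \<omega> \<le> 0"
      using greedy_hypervolume[OF gs(2,1) k_pos] xs(3) True by (simp add: regret_def)
    then show ?thesis by simp
  next
    case False
    then show ?thesis
      using cb.first_deviation_gap[OF g xs(1) gs(2,1)] gs(3) act xs(3) by simp
  qed
qed

section \<open>Accumulated regret in expectation\<close>

text \<open>With the log level frozen at the horizon, the bound on a radius depends on the round
  only through the pull count, as the summation over pulls requires.\<close>

definition radius_scale :: real where
  "radius_scale = sqrt (2 * \<eta> * log_level T)"

lemma radius_scale_pos: "1 \<le> T \<Longrightarrow> 0 < radius_scale"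
  using log_level_pos[of T] \<eta>_pos by (simp add: radius_scale_def)

lemma radius_le:
  assumes "t \<in> {1..T}"
  shows "radius \<omega> i t \<le> radius_scale / sqrt (max 1 (real (num_pulls \<omega> i (t - 1))))"
proof -
  have "0 < real n * real CARD('d) * (real t)\<^sup>2 / \<delta>"
    using log_level_arg_gt_1[of t] assms by simp
  moreover have "real n * real CARD('d) * (real t)\<^sup>2 / \<delta> \<le> real n * real CARD('d) * (real T)\<^sup>2 / \<delta>"
    using assms \<delta>_pos by (intro divide_right_mono mult_left_mono power_mono) auto
  ultimately have "log_level t \<le> log_level T" unfolding log_level_def by simp
  then have "sqrt (2 * \<eta> * log_level t) \<le> radius_scale"
    using \<eta>_pos by (simp add: radius_scale_def)
  then show ?thesis
    by (simp add: radius_def real_sqrt_divide divide_right_mono)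
qed

lemma sum_num_pulls:
  assumes "\<omega> \<in> space M"
  shows "(\<Sum>i\<in>{1..n}. real (num_pulls \<omega> i T)) = real k * real T"
proof -
  have "(\<Sum>i\<in>{1..n}. real (num_pulls \<omega> i T)) = (\<Sum>t\<in>{1..T}. \<Sum>i\<in>S t \<omega>. 1)"
    using sum_over_pulls[of "{1..n}" T "\<lambda>t. S t \<omega>" "\<lambda>_. 1"] slate_subset[OF _ assms] by simp
  also have "\<dots> = (\<Sum>t\<in>{1..T}. real k)"
    using card_slate[OF _ assms] by (intro sum.cong) auto
  finally show ?thesis by simp
qed

text \<open>Every initialization round thus uses up one of the first \<open>m0\<close> pulls of some
  arm, so there are at most \<open>n * m0\<close> such rounds.\<close>

lemma initializing_least_pulled:
  assumes t: "t \<in> {1..T}" and \<omega>: "\<omega> \<in> space M" and ini: "initializing \<omega> t"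
  shows "\<exists>i\<in>S t \<omega>. num_pulls \<omega> i (t - 1) < m0"
proof -
  have lp: "least_pulled n k (\<lambda>t. S t \<omega>) t"
    using round_played[OF t \<omega>] ini by simp
  obtain i where i: "i \<in> {1..n}" "num_pulls \<omega> i (t - 1) < m0"
    using ini by (auto simp: init_round_def)
  obtain j where j: "j \<in> S t \<omega>"
    using card_slate[OF t \<omega>] k_pos by fastforce
  show ?thesis
  proof (cases "i \<in> S t \<omega>")
    case False
    then have "num_pulls \<omega> j (t - 1) \<le> num_pulls \<omega> i (t - 1)"
      using lp i j by (auto simp: least_pulled_def)
    then show ?thesis using i j by (intro bexI[of _ j]) auto
  qed (use i in auto)
qed

lemma integrable_regret:
  assumes t: "t \<in> {1..T}"
  shows "integrable M (regret t)"
proof -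
  have "S t \<in> measurable M (count_space UNIV)"
    by (rule measurable_from_subalg[OF F_sub slate_predictable[OF t]])
  then have "(\<lambda>\<omega>. hypervolume r \<mu> (S t \<omega>)) \<in> borel_measurable M"
    by (rule measurable_compose) simp
  moreover have "AE \<omega> in M. norm (hypervolume r \<mu> (S t \<omega>)) \<le> hv_lip r"
    using hypervolume_mean_le[OF _ slate_subset[OF t]] t by (intro AE_I2) auto
  ultimately have "integrable M (\<lambda>\<omega>. hypervolume r \<mu> (S t \<omega>))"
    by (intro integrable_const_bound)
  then show ?thesis by (simp add: regret_def[abs_def])
qed

lemma approx_regret_eq: "approx_regret n k T r \<mu> (\<lambda>t. S t \<omega>) = (\<Sum>t\<in>{1..T}. regret t \<omega>)"
  by (simp add: approx_regret_def regret_def)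

lemma integrable_approx_regret: "integrable M (\<lambda>\<omega>. approx_regret n k T r \<mu> (\<lambda>t. S t \<omega>))"
  unfolding approx_regret_eq using integrable_regret by (intro Bochner_Integration.integrable_sum)

lemma expected_regret_le_horizon:
  assumes "1 \<le> T"
  shows "expectation (\<lambda>\<omega>. approx_regret n k T r \<mu> (\<lambda>t. S t \<omega>)) \<le> hv_lip r * real T"
proof -
  have "approx_regret n k T r \<mu> (\<lambda>t. S t \<omega>) \<le> hv_lip r * real T" for \<omega>
    using sum_bounded_above[of "{1..T}" "\<lambda>t. regret t \<omega>" "hv_lip r"] regret_le[OF assms]
    by (simp add: approx_regret_eq mult.commute)
  then show ?thesis
    using integral_mono[OF integrable_approx_regret, of "\<lambda>_. hv_lip r * real T"] by (simp add: prob_space)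
qed

text \<open>For one arm the minimum gap is \<infinity> and the gap term vanishes, so this case is
  settled directly: there is only one slate, and it is optimal.\<close>

lemma expected_regret_single_arm:
  assumes "n = 1"
  shows "expectation (\<lambda>\<omega>. approx_regret n k T r \<mu> (\<lambda>t. S t \<omega>)) \<le> 0"
proof -
  have full: "B = {1..n}" if "B \<subseteq> {1..n}" "card B = k" for B
    using that k_pos k_le assms by (intro card_subset_eq) auto
  obtain B where B: "B \<subseteq> {1..n}" "card B = k" "opt_value n k r \<mu> = hypervolume r \<mu> B"
    by (rule optimal_slate)
  have "regret t \<omega> \<le> 0" if "t \<in> {1..T}" "\<omega> \<in> space M" for t \<omega>
  proof -
    have "S t \<omega> = B"
      using full[OF B(1,2)] full[OF slate_subset card_slate, OF that that] by simp
    moreover have "(1 - 1 / exp 1) * hypervolume r \<mu> B \<le> 1 * hypervolume r \<mu> B"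
      by (intro mult_right_mono) auto
    ultimately show ?thesis by (simp add: regret_def B(3))
  qed
  then have "approx_regret n k T r \<mu> (\<lambda>t. S t \<omega>) \<le> 0" if "\<omega> \<in> space M" for \<omega>
    unfolding approx_regret_eq using that by (intro sum_nonpos) auto
  then show ?thesis
    using integral_mono[OF integrable_approx_regret, of "\<lambda>_. 0"] by simp
qed

text \<open>The accounting common to both rates. A round is initializing, or hit by a failure event,
  or charged \<open>g\<close> at the pull counts of its arms. The first two kinds cost at most
  \<open>hv_lip r\<close> each. The charge is assumed only almost surely because the safety of
  pruning is.\<close>

lemma expected_regret_le:
  fixes g :: "nat \<Rightarrow> real"
  assumes T: "1 \<le> T" and g0: "\<And>m. 0 \<le> g m"
    and main: "AE \<omega> in M. \<forall>t\<in>{1..T}. \<not> initializing \<omega> t \<longrightarrow> concentrated \<omega> t \<longrightarrow>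
      regret t \<omega> \<le> (\<Sum>i\<in>S t \<omega>. g (num_pulls \<omega> i (t - 1)))"
    and G: "\<And>\<omega>. \<omega> \<in> space M \<Longrightarrow> (\<Sum>i\<in>{1..n}. \<Sum>m<num_pulls \<omega> i T. g m) \<le> G"
  shows "expectation (\<lambda>\<omega>. approx_regret n k T r \<mu> (\<lambda>t. S t \<omega>))
    \<le> G + hv_lip r * (real n * real m0) + 2 * hv_lip r * real T * \<delta>"
proof -
  note L = less_imp_le[OF hv_lip_pos[of r]]
  have "\<forall>t\<in>{1..T}. \<exists>E. E \<in> events \<and> prob E \<le> 2 * \<delta> \<and> (\<forall>\<omega>\<in>space M - E. concentrated \<omega> t)"
    using exceptional_event unfolding concentrated_def by blast
  then obtain E where E: "\<And>t. t \<in> {1..T} \<Longrightarrow> E t \<in> events \<and> prob (E t) \<le> 2 * \<delta>"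
    and conc: "\<And>t \<omega>. t \<in> {1..T} \<Longrightarrow> \<omega> \<in> space M - E t \<Longrightarrow> concentrated \<omega> t"
    by metis
  let ?Z = "\<lambda>\<omega>. G + hv_lip r * (real n * real m0) + hv_lip r * (\<Sum>t\<in>{1..T}. indicator (E t) \<omega>)"
  have pointwise: "approx_regret n k T r \<mu> (\<lambda>t. S t \<omega>) \<le> ?Z \<omega>"
    if \<omega>: "\<omega> \<in> space M" and m: "\<forall>t\<in>{1..T}. \<not> initializing \<omega> t \<longrightarrow> concentrated \<omega> t \<longrightarrow>
      regret t \<omega> \<le> (\<Sum>i\<in>S t \<omega>. g (num_pulls \<omega> i (t - 1)))" for \<omega>
  proof -
    let ?f = "\<lambda>t. \<Sum>i\<in>S t \<omega>. of_bool (num_pulls \<omega> i (t - 1) < m0) :: real"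
    have "regret t \<omega> \<le> (\<Sum>i\<in>S t \<omega>. g (num_pulls \<omega> i (t - 1))) + hv_lip r * ?f t + hv_lip r * indicator (E t) \<omega>"
      if t: "t \<in> {1..T}" for t
    proof -
      have fin: "finite (S t \<omega>)" using slate_subset[OF t \<omega>] finite_subset by blast
      have nonneg: "0 \<le> (\<Sum>i\<in>S t \<omega>. g (num_pulls \<omega> i (t - 1)))" "0 \<le> hv_lip r * ?f t"
        "0 \<le> hv_lip r * indicator (E t) \<omega>"
        using g0 L by (auto intro!: sum_nonneg mult_nonneg_nonneg)
      consider "initializing \<omega> t" | "\<omega> \<in> E t" | "\<not> initializing \<omega> t" "\<omega> \<in> space M - E t"
        using \<omega> by blast
      then show ?thesis
      proof cases
        case 1
        then obtain i where i: "i \<in> S t \<omega>" "num_pulls \<omega> i (t - 1) < m0"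
          using initializing_least_pulled[OF t \<omega>] by blast
        then have "1 \<le> ?f t"
          using member_le_sum[OF i(1), of "\<lambda>i. of_bool (num_pulls \<omega> i (t - 1) < m0) :: real"] fin by simp
        then have "hv_lip r * 1 \<le> hv_lip r * ?f t" using L by (intro mult_left_mono)
        then show ?thesis using regret_le[OF T, of t \<omega>] nonneg by linarith
      next
        case 2
        then show ?thesis using regret_le[OF T, of t \<omega>] nonneg by simp
      next
        case 3
        then show ?thesis using m t conc[OF t] nonneg by fastforce
      qed
    qed
    then have "approx_regret n k T r \<mu> (\<lambda>t. S t \<omega>)
        \<le> (\<Sum>t\<in>{1..T}. (\<Sum>i\<in>S t \<omega>. g (num_pulls \<omega> i (t - 1))) + hv_lip r * ?f t + hv_lip r * indicator (E t) \<omega>)"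
      unfolding approx_regret_eq by (intro sum_mono)
    also have "\<dots> = (\<Sum>t\<in>{1..T}. \<Sum>i\<in>S t \<omega>. g (num_pulls \<omega> i (t - 1))) + hv_lip r * (\<Sum>t\<in>{1..T}. ?f t)
        + hv_lip r * (\<Sum>t\<in>{1..T}. indicator (E t) \<omega>)"
      by (simp add: sum.distrib sum_distrib_left)
    also have "(\<Sum>t\<in>{1..T}. \<Sum>i\<in>S t \<omega>. g (num_pulls \<omega> i (t - 1))) \<le> G"
      using G[OF \<omega>] sum_over_pulls[of "{1..n}" T "\<lambda>t. S t \<omega>" g] slate_subset[OF _ \<omega>] by simp
    also have "(\<Sum>t\<in>{1..T}. ?f t) = (\<Sum>i\<in>{1..n}. \<Sum>m<num_pulls \<omega> i T. of_bool (m < m0))"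
      using sum_over_pulls[of "{1..n}" T "\<lambda>t. S t \<omega>" "\<lambda>m. of_bool (m < m0)"] slate_subset[OF _ \<omega>] by simp
    also have "\<dots> \<le> (\<Sum>i\<in>{1..n}. real m0)"
    proof (rule sum_mono)
      fix i
      have "(\<Sum>m<num_pulls \<omega> i T. of_bool (m < m0)) = real (card ({..<num_pulls \<omega> i T} \<inter> {m. m < m0}))"
        by (simp add: sum.If_cases of_bool_def)
      also have "\<dots> \<le> real (card {..<m0})"
        by (intro of_nat_mono card_mono) auto
      finally show "(\<Sum>m<num_pulls \<omega> i T. of_bool (m < m0)) \<le> real m0" by simp
    qed
    finally show ?thesis using L by (simp add: mult_left_mono)
  qed
  have ind: "integrable M (indicator (E t) :: 'a \<Rightarrow> real)" if "t \<in> {1..T}" for t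
    using E[OF that] by (simp add: integrable_indicator_iff emeasure_eq_measure)
  have "expectation (\<lambda>\<omega>. approx_regret n k T r \<mu> (\<lambda>t. S t \<omega>)) \<le> expectation ?Z"
  proof (rule integral_mono_AE[OF integrable_approx_regret])
    show "integrable M ?Z"
      using ind by (intro Bochner_Integration.integrable_add integrable_mult_right
          Bochner_Integration.integrable_sum) auto
    show "AE \<omega> in M. approx_regret n k T r \<mu> (\<lambda>t. S t \<omega>) \<le> ?Z \<omega>"
      using main by (rule AE_mp) (intro AE_I2 impI pointwise)
  qed
  also have "\<dots> = G + hv_lip r * (real n * real m0) + hv_lip r * (\<Sum>t\<in>{1..T}. prob (E t))"
  proof -
    have "expectation (indicator (E t)) = prob (E t)" if "t \<in> {1..T}" for t
      using E[OF that] by (simp add: Int_absorb2 sets.sets_into_space)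
    then have "expectation (\<lambda>\<omega>. \<Sum>t\<in>{1..T}. indicator (E t) \<omega>) = (\<Sum>t\<in>{1..T}. prob (E t))"
      by (subst Bochner_Integration.integral_sum[OF ind]) auto
    moreover have "integrable M (\<lambda>\<omega>. \<Sum>t\<in>{1..T}. indicator (E t) \<omega> :: real)"
      using ind by (rule Bochner_Integration.integrable_sum)
    ultimately show ?thesis by (simp add: prob_space del: One_nat_def)
  qed
  also have "hv_lip r * (\<Sum>t\<in>{1..T}. prob (E t)) \<le> hv_lip r * (\<Sum>t\<in>{1..T}. 2 * \<delta>)"
    using E L by (intro mult_left_mono sum_mono) auto
  finally show ?thesis by (simp add: mult_ac)
qed

lemma expected_regret_worst_case:
  assumes T: "1 \<le> T"
  shows "expectation (\<lambda>\<omega>. approx_regret n k T r \<mu> (\<lambda>t. S t \<omega>))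
    \<le> 3 * hv_lip r * radius_scale * sqrt (real n * real k * real T)
      + hv_lip r * (real n * real m0) + 2 * hv_lip r * real T * \<delta>"
proof (rule expected_regret_le[OF T])
  let ?g = "\<lambda>m. hv_lip r * (radius_scale / sqrt (max 1 (real m)))"
  show "0 \<le> ?g m" for m using hv_lip_pos[of r] radius_scale_pos[OF T] by simp
  show "AE \<omega> in M. \<forall>t\<in>{1..T}. \<not> initializing \<omega> t \<longrightarrow> concentrated \<omega> t \<longrightarrow>
      regret t \<omega> \<le> (\<Sum>i\<in>S t \<omega>. ?g (num_pulls \<omega> i (t - 1)))"
  proof (intro AE_I2 ballI impI)
    fix \<omega> t assume *: "\<omega> \<in> space M" "t \<in> {1..T}" "\<not> initializing \<omega> t" "concentrated \<omega> t"
    have "regret t \<omega> \<le> hv_lip r * (\<Sum>i\<in>S t \<omega>. radius \<omega> i t)"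
      by (rule main_round_regret_le) fact+
    also have "\<dots> \<le> hv_lip r * (\<Sum>i\<in>S t \<omega>. radius_scale / sqrt (max 1 (real (num_pulls \<omega> i (t - 1)))))"
      using hv_lip_pos[of r] * by (intro mult_left_mono sum_mono radius_le) auto
    finally show "regret t \<omega> \<le> (\<Sum>i\<in>S t \<omega>. ?g (num_pulls \<omega> i (t - 1)))"
      by (simp only: sum_distrib_left)
  qed
  fix \<omega> assume \<omega>: "\<omega> \<in> space M"
  have "(\<Sum>i\<in>{1..n}. \<Sum>m<num_pulls \<omega> i T. ?g m)
      = hv_lip r * radius_scale * (\<Sum>i\<in>{1..n}. \<Sum>m<num_pulls \<omega> i T. 1 / sqrt (max 1 (real m)))"
    by (simp add: sum_distrib_left)
  also have "\<dots> \<le> hv_lip r * radius_scale * (\<Sum>i\<in>{1..n}. 3 * sqrt (real (num_pulls \<omega> i T)))"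
    using hv_lip_pos[of r] radius_scale_pos[OF T] by (intro mult_left_mono sum_mono sum_inverse_sqrt_le) auto
  also have "(\<Sum>i\<in>{1..n}. 3 * sqrt (real (num_pulls \<omega> i T))) = 3 * (\<Sum>i\<in>{1..n}. sqrt (real (num_pulls \<omega> i T)))"
    by (simp add: sum_distrib_left)
  \<comment> \<open>Cauchy-Schwarz over the arms, whose pulls total \<open>k * T\<close>.\<close>
  also have "(\<Sum>i\<in>{1..n}. sqrt (real (num_pulls \<omega> i T))) \<le> sqrt (real n * real k * real T)"
    using sum_sqrt_le[of "{1..n}" "\<lambda>i. real (num_pulls \<omega> i T)"]
    unfolding sum_num_pulls[OF \<omega>] by (simp add: mult.assoc)
  finally show "(\<Sum>i\<in>{1..n}. \<Sum>m<num_pulls \<omega> i T. ?g m)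
      \<le> 3 * hv_lip r * radius_scale * sqrt (real n * real k * real T)"
    using hv_lip_pos[of r] radius_scale_pos[OF T] by (simp add: mult_left_mono mult_ac)
qed

text \<open>In a round with positive regret the total overestimation is at least \<open>D\<close>. Radii below
  \<open>D / (2 * hv_lip r * k)\<close> account for at most half of it, so they can be dropped at the price of a
  factor 2; only the rounds in which an arm still has a large radius remain.\<close>

lemma expected_regret_gap:
  assumes T: "1 \<le> T" and D: "0 < D" "\<And>m i. m < k \<Longrightarrow> i \<in> {1..n} - {gs ! m} \<Longrightarrow> D \<le> stage_gap (hypervolume r \<mu>) gs m i"
    and gs: "length gs = k" "greedy_seq (hypervolume r \<mu>) {1..n} gs"
    and unpruned: "AE \<omega> in M. \<forall>t\<in>{1..T}. \<not> initializing \<omega> t \<longrightarrow> set gs \<subseteq> active_at \<omega> t"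
  shows "expectation (\<lambda>\<omega>. approx_regret n k T r \<mu> (\<lambda>t. S t \<omega>))
    \<le> 20 * (hv_lip r)\<^sup>2 * radius_scale\<^sup>2 * (real n * real k / D)
      + hv_lip r * (real n * real m0) + 2 * hv_lip r * real T * \<delta>"
proof (rule expected_regret_le[OF T])
  define c where "c = D / (2 * hv_lip r * real k)"
  have L: "0 < hv_lip r" by (rule hv_lip_pos)
  have k: "0 < real k" using k_pos by simp
  have c: "0 < c" using D L k by (simp add: c_def)
  have c2: "hv_lip r * (real k * c) = D / 2" using L k by (simp add: c_def)
  let ?\<rho> = "\<lambda>m. radius_scale / sqrt (max 1 (real m))"
  let ?trunc = "\<lambda>m. if c < ?\<rho> m then ?\<rho> m else 0"
  let ?g = "\<lambda>m. 2 * hv_lip r * ?trunc m"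
  show g0: "0 \<le> ?g m" for m using L radius_scale_pos[OF T] by simp
  show "AE \<omega> in M. \<forall>t\<in>{1..T}. \<not> initializing \<omega> t \<longrightarrow> concentrated \<omega> t \<longrightarrow>
      regret t \<omega> \<le> (\<Sum>i\<in>S t \<omega>. ?g (num_pulls \<omega> i (t - 1)))"
    using unpruned
  proof (rule AE_mp, intro AE_I2 impI ballI)
    fix \<omega> t assume \<omega>: "\<omega> \<in> space M" and t: "t \<in> {1..T}" and main: "\<not> initializing \<omega> t" and conc: "concentrated \<omega> t"
      and un: "\<forall>t\<in>{1..T}. \<not> initializing \<omega> t \<longrightarrow> set gs \<subseteq> active_at \<omega> t"
    let ?N = "\<lambda>i. num_pulls \<omega> i (t - 1)"
    define B where "B = hv_lip r * (\<Sum>i\<in>S t \<omega>. ?\<rho> (?N i))"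
    have rB: "hv_lip r * (\<Sum>i\<in>S t \<omega>. radius \<omega> i t) \<le> B"
      unfolding B_def using L t by (intro mult_left_mono sum_mono radius_le) auto
    have "regret t \<omega> \<le> 0 \<or> D \<le> B"
      using main_round_gap[OF t \<omega> main conc gs] un t main D(2) rB by fastforce
    then show "regret t \<omega> \<le> (\<Sum>i\<in>S t \<omega>. ?g (?N i))"
    proof
      assume "regret t \<omega> \<le> 0"
      also have "0 \<le> (\<Sum>i\<in>S t \<omega>. ?g (?N i))" using g0 by (intro sum_nonneg)
      finally show ?thesis .
    next
      assume DB: "D \<le> B"
      have "B \<le> hv_lip r * (\<Sum>i\<in>S t \<omega>. ?trunc (?N i) + c)"
        unfolding B_def using L c by (intro mult_left_mono sum_mono) auto
      also have "\<dots> = hv_lip r * (\<Sum>i\<in>S t \<omega>. ?trunc (?N i)) + D / 2"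
        using c2 by (simp only: sum.distrib sum_constant distrib_left card_slate[OF t \<omega>] of_nat_id)
      finally have "B \<le> 2 * (hv_lip r * (\<Sum>i\<in>S t \<omega>. ?trunc (?N i)))" using DB by linarith
      also have "\<dots> = (\<Sum>i\<in>S t \<omega>. ?g (?N i))"
        by (simp only: sum_distrib_left mult.assoc)
      finally show ?thesis
        using main_round_regret_le[OF t \<omega> main conc] rB by linarith
    qed
  qed
  fix \<omega> assume \<omega>: "\<omega> \<in> space M"
  have "(\<Sum>i\<in>{1..n}. \<Sum>m<num_pulls \<omega> i T. ?g m) = (\<Sum>i\<in>{1..n}. 2 * hv_lip r * (\<Sum>m<num_pulls \<omega> i T. ?trunc m))"
    by (simp only: sum_distrib_left)
  also have "\<dots> \<le> (\<Sum>i\<in>{1..n}. 2 * hv_lip r * (5 * radius_scale\<^sup>2 / c))"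
    using L c radius_scale_pos[OF T] by (intro sum_mono mult_left_mono sum_truncated_inverse_sqrt_le) auto
  \<comment> \<open>The 20 is the product of the 2 lost by truncation, the 5 of the truncated sum
    and the 2 in the denominator of \<open>c\<close>.\<close>
  also have "\<dots> = 20 * (hv_lip r)\<^sup>2 * radius_scale\<^sup>2 * (real n * real k / D)"
    using D L k by (simp add: c_def field_simps power2_eq_square)
  finally show "(\<Sum>i\<in>{1..n}. \<Sum>m<num_pulls \<omega> i T. ?g m)
      \<le> 20 * (hv_lip r)\<^sup>2 * radius_scale\<^sup>2 * (real n * real k / D)" .
qed

end

section \<open>Rates\<close>

text \<open>At \<open>T = 0\<close> the quotient is 0, contradicting \<open>0 < \<delta>\<close>,
  and at \<open>T = 1\<close> it is 1, contradicting \<open>\<delta> < 1\<close>.\<close>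

lemma (in thv_ucb_run) horizon_ge_2: "\<delta> = 1 / real T \<Longrightarrow> 2 \<le> T"
  using \<delta>_pos \<delta>_less by (cases "T = 0 \<or> T = 1") auto

lemma ln_ge_half:
  assumes "2 \<le> T"
  shows "1 / 2 \<le> ln (real T)"
proof -
  have "1 / 2 \<le> ln (2::real)" using ln2_ge_two_thirds by simp
  also have "\<dots> \<le> ln (real T)" using assms by simp
  finally show ?thesis .
qed

text \<open>At the horizon the argument is \<open>n * d * T ^ 3\<close> for dimension
  \<open>d\<close>. The powers of \<open>T\<close> and \<open>ln n \<le> ln T\<close> give the 4,
  and \<open>ln d \<le> d \<le> 2 * d * ln T\<close> gives the rest.\<close>

lemma (in thv_ucb_run) log_level_horizon_le:
  assumes \<delta>: "\<delta> = 1 / real T" and n: "n \<le> T"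
  shows "log_level T \<le> (4 + 2 * real CARD('d)) * ln (real T)"
proof -
  have T: "2 \<le> T" by (rule horizon_ge_2[OF \<delta>])
  have pos: "0 < real n" "0 < real T" "0 < real CARD('d)" using k_pos k_le T by auto
  have "log_level T = ln (real n) + ln (real CARD('d)) + 3 * ln (real T)"
    using pos unfolding log_level_def unfolding \<delta> by (simp add: ln_mult ln_realpow)
  moreover have "ln (real n) \<le> ln (real T)" using n pos by simp
  moreover have "ln (real CARD('d)) \<le> real CARD('d) * (2 * ln (real T))"
  proof -
    have "ln (real CARD('d)) \<le> real CARD('d) * 1" using ln_le_minus_one[OF pos(3)] by simp
    also have "\<dots> \<le> real CARD('d) * (2 * ln (real T))"
      using ln_ge_half[OF T] by (intro mult_left_mono) auto
    finally show ?thesis .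
  qed
  ultimately show ?thesis by (simp add: algebra_simps)
qed

lemma (in thv_ucb_run) radius_scale_sq_le:
  assumes \<delta>: "\<delta> = 1 / real T" and n: "n \<le> T"
  shows "radius_scale\<^sup>2 \<le> 2 * \<eta> * (4 + 2 * real CARD('d)) * ln (real T)"
proof -
  have "radius_scale\<^sup>2 = 2 * \<eta> * log_level T"
    using log_level_pos[of T] horizon_ge_2[OF \<delta>] \<eta>_pos by (simp add: radius_scale_def)
  also have "\<dots> \<le> 2 * \<eta> * ((4 + 2 * real CARD('d)) * ln (real T))"
    using \<eta>_pos by (intro mult_left_mono log_level_horizon_le[OF \<delta> n]) auto
  finally show ?thesis by simp
qed

text \<open>For \<open>T \<le> n\<close> both rates hold because the right-hand side is at least of order \<open>T\<close>. This is what
  allows \<open>ln (n * d * T\<^sup>3)\<close> to be replaced by a multiple of \<open>ln T\<close>.\<close>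

lemma (in thv_ucb_run) worst_case_rate:
  assumes \<delta>: "\<delta> = 1 / real T"
  shows "expectation (\<lambda>\<omega>. approx_regret n k T r \<mu> (\<lambda>t. S t \<omega>))
    \<le> hv_lip r * (3 * sqrt (2 * \<eta> * (4 + 2 * real CARD('d))) + 2 * real m0 + 2)
      * sqrt (real n * real k * real T * ln (real T)) + 2 * hv_lip r"
proof -
  have T: "2 \<le> T" by (rule horizon_ge_2[OF \<delta>])
  note L = hv_lip_pos[of r]
  let ?E = "expectation (\<lambda>\<omega>. approx_regret n k T r \<mu> (\<lambda>t. S t \<omega>))"
  let ?Q = "sqrt (real n * real k * real T * ln (real T))"
  let ?s = "sqrt (2 * \<eta> * (4 + 2 * real CARD('d)))"
  have s: "0 \<le> ?s" using \<eta>_pos by simp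
  \<comment> \<open>The minimum of \<open>n\<close> and \<open>T\<close> is at most their geometric
    mean. This serves both cases: for \<open>n \<le> T\<close> it absorbs the initialization cost,
    for \<open>T < n\<close> the trivial regret.\<close>
  have min_le: "real (min n T) \<le> 2 * ?Q"
  proof -
    let ?m = "real (min n T)"
    have "?m\<^sup>2 \<le> real n * real T"
      by (simp add: power2_eq_square mult_mono)
    also have "\<dots> = (real n * 1 * real T) * 1" by simp
    also have "\<dots> \<le> (real n * real k * real T) * (4 * ln (real T))"
      using k_pos ln_ge_half[OF T] by (intro mult_mono) auto
    finally have "?m\<^sup>2 \<le> 4 * (real n * real k * real T * ln (real T))" by simp
    then have "?m \<le> sqrt (4 * (real n * real k * real T * ln (real T)))" by (rule real_le_rsqrt)
    then show ?thesis by (simp add: real_sqrt_mult)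
  qed
  have Q: "0 \<le> ?Q" using ln_ge_half[OF T] by simp
  show ?thesis
  proof (cases "n \<le> T")
    case True
    have "radius_scale \<le> ?s * sqrt (ln (real T))"
      using real_le_rsqrt[OF radius_scale_sq_le[OF \<delta> True]] by (simp only: real_sqrt_mult)
    then have "radius_scale * sqrt (real n * real k * real T) \<le> ?s * sqrt (ln (real T)) * sqrt (real n * real k * real T)"
      by (intro mult_right_mono) auto
    also have "\<dots> = ?s * ?Q" by (simp add: real_sqrt_mult)
    finally have 1: "3 * hv_lip r * (radius_scale * sqrt (real n * real k * real T)) \<le> 3 * hv_lip r * (?s * ?Q)"
      using L by (intro mult_left_mono) auto
    have "real n \<le> 2 * ?Q" using min_le True by (simp add: min_def)
    then have "hv_lip r * (real n * real m0) \<le> hv_lip r * (2 * ?Q * real m0)"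
      using L by (intro mult_left_mono mult_right_mono) auto
    moreover have "0 \<le> hv_lip r * ?Q" using L Q by simp
    moreover have "?E \<le> 3 * hv_lip r * (radius_scale * sqrt (real n * real k * real T))
        + hv_lip r * (real n * real m0) + 2 * hv_lip r"
      using expected_regret_worst_case T \<delta> by (simp add: mult.assoc)
    ultimately have "?E \<le> 3 * hv_lip r * (?s * ?Q) + hv_lip r * (2 * ?Q * real m0) + 2 * (hv_lip r * ?Q) + 2 * hv_lip r"
      using 1 by linarith
    also have "\<dots> = hv_lip r * (3 * ?s + 2 * real m0 + 2) * ?Q + 2 * hv_lip r"
      by (simp add: algebra_simps)
    finally show ?thesis .
  next
    case False
    have "?E \<le> hv_lip r * real T" using expected_regret_le_horizon T by simp
    also have "\<dots> \<le> hv_lip r * (2 * ?Q)"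
      using min_le False L by (intro mult_left_mono) (auto simp: min_def)
    also have "\<dots> \<le> hv_lip r * ((3 * ?s + 2 * real m0 + 2) * ?Q)"
      using L Q s by (intro mult_left_mono mult_right_mono) auto
    finally show ?thesis using L by simp
  qed
qed

lemma (in thv_ucb_run) gap_rate:
  assumes \<delta>: "\<delta> = 1 / real T"
    and D: "0 < D" "D \<le> hv_lip r"
      "\<And>m i. m < k \<Longrightarrow> i \<in> {1..n} - {gs ! m} \<Longrightarrow> D \<le> stage_gap (hypervolume r \<mu>) gs m i"
    and gs: "length gs = k" "greedy_seq (hypervolume r \<mu>) {1..n} gs"
    and unpruned: "AE \<omega> in M. \<forall>t\<in>{1..T}. \<not> initializing \<omega> t \<longrightarrow> set gs \<subseteq> active_at \<omega> t"
  shows "expectation (\<lambda>\<omega>. approx_regret n k T r \<mu> (\<lambda>t. S t \<omega>))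
    \<le> (hv_lip r)\<^sup>2 * (40 * \<eta> * (4 + 2 * real CARD('d)) + 2 * real m0 + 2)
      * (real n * real k powr (5 / 2) * ln (real T)) / D + 2 * hv_lip r"
proof -
  have T: "2 \<le> T" by (rule horizon_ge_2[OF \<delta>])
  note L = hv_lip_pos[of r]
  let ?E = "expectation (\<lambda>\<omega>. approx_regret n k T r \<mu> (\<lambda>t. S t \<omega>))"
  let ?K = "real k powr (5 / 2)"
  define Q where "Q = real n * ?K * ln (real T) / D"
  have lnT: "1 \<le> 2 * ln (real T)" using ln_ge_half[OF T] by simp
  have k1: "1 \<le> real k" using k_pos by simp
  \<comment> \<open>The estimate obtained so far is linear in \<open>k\<close>; it is relaxed here
    to the exponent of the stated rate.\<close>
  have K: "real k \<le> ?K" using powr_mono[of 1 "5 / 2" "real k"] k1 by simp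
  have Q0: "0 \<le> Q" unfolding Q_def using lnT D by simp
  \<comment> \<open>Since \<open>D \<le> hv_lip r\<close>, the last factor is at least 1, so
    \<open>n\<close> itself is of the order of the rate. This pays for the initialization, and for
    the trivial regret when \<open>T < n\<close>.\<close>
  have "real n * 1 * 1 * 1 \<le> real n * ?K * (2 * ln (real T)) * (hv_lip r / D)"
    using K k1 lnT D by (intro mult_mono) auto
  then have nQ: "real n \<le> 2 * hv_lip r * Q" by (simp add: Q_def mult_ac)
  have *: "?E \<le> (hv_lip r)\<^sup>2 * (40 * \<eta> * (4 + 2 * real CARD('d)) + 2 * real m0 + 2) * Q + 2 * hv_lip r"
  proof (cases "n \<le> T")
    case True
    have "real n * real k / D \<le> real n * ?K / D"
      using K D by (intro divide_right_mono mult_left_mono) auto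
    then have "radius_scale\<^sup>2 * (real n * real k / D)
        \<le> (2 * \<eta> * (4 + 2 * real CARD('d)) * ln (real T)) * (real n * ?K / D)"
      using radius_scale_sq_le[OF \<delta> True] D lnT \<eta>_pos by (intro mult_mono) auto
    then have "radius_scale\<^sup>2 * (real n * real k / D) \<le> 2 * \<eta> * (4 + 2 * real CARD('d)) * Q"
      by (simp add: Q_def mult_ac)
    then have "20 * (hv_lip r)\<^sup>2 * (radius_scale\<^sup>2 * (real n * real k / D))
        \<le> 20 * (hv_lip r)\<^sup>2 * (2 * \<eta> * (4 + 2 * real CARD('d)) * Q)"
      by (intro mult_left_mono) auto
    moreover have "hv_lip r * (real n * real m0) \<le> hv_lip r * (2 * hv_lip r * Q * real m0)"
      using nQ L by (intro mult_left_mono mult_right_mono) auto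
    moreover have "0 \<le> (hv_lip r)\<^sup>2 * Q" using Q0 by simp
    moreover have "?E \<le> 20 * (hv_lip r)\<^sup>2 * (radius_scale\<^sup>2 * (real n * real k / D))
        + hv_lip r * (real n * real m0) + 2 * hv_lip r"
      using expected_regret_gap[OF _ D(1,3) gs unpruned] T \<delta> by (simp add: mult.assoc)
    ultimately have "?E \<le> 20 * (hv_lip r)\<^sup>2 * (2 * \<eta> * (4 + 2 * real CARD('d)) * Q)
        + hv_lip r * (2 * hv_lip r * Q * real m0) + 2 * ((hv_lip r)\<^sup>2 * Q) + 2 * hv_lip r"
      by linarith
    also have "\<dots> = (hv_lip r)\<^sup>2 * (40 * \<eta> * (4 + 2 * real CARD('d)) + 2 * real m0 + 2) * Q + 2 * hv_lip r"
      by (simp add: algebra_simps power2_eq_square)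
    finally show ?thesis .
  next
    case False
    have "?E \<le> hv_lip r * real T" using expected_regret_le_horizon T by simp
    also have "\<dots> \<le> hv_lip r * (2 * hv_lip r * Q)"
      using nQ False L by (intro mult_left_mono) auto
    also have "\<dots> = (hv_lip r)\<^sup>2 * 2 * Q" by (simp add: power2_eq_square)
    also have "\<dots> \<le> (hv_lip r)\<^sup>2 * (40 * \<eta> * (4 + 2 * real CARD('d)) + 2 * real m0 + 2) * Q"
      using Q0 \<eta>_pos by (intro mult_right_mono mult_left_mono) auto
    finally show ?thesis using L by simp
  qed
  then show ?thesis by (simp add: Q_def)
qed

section \<open>The minimum gap and the final bounds\<close>

lemma min_gap_le:
  "m < length gs \<Longrightarrow> i \<in> A - {gs ! m} \<Longrightarrow> min_gap f A gs \<le> ereal (stage_gap f gs m i)"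
  unfolding min_gap_def by (intro INF_lower2[of m] INF_lower) auto

text \<open>The gaps are also taken against arms chosen at earlier stages, whose marginal value is 0.\<close>

lemma stage_gap_nonneg:
  assumes gs: "greedy_seq (hypervolume r v) A gs" and m: "m < length gs" and i: "i \<in> A"
  shows "0 \<le> stage_gap (hypervolume r v) gs m i"
proof (cases "i \<in> set (take m gs)")
  case True
  then have "marginal (hypervolume r v) (set (take m gs)) i = 0"
    by (simp add: marginal_def insert_absorb)
  then show ?thesis by (simp add: stage_gap_def marginal_hypervolume_nonneg)
next
  case False
  then show ?thesis using greedy_seq_nth(2)[OF gs m] i by (simp add: stage_gap_def)
qed

text \<open>With two arms the first stage has a competitor, and its gap is at most the volume of the
  single box of \<open>gs ! 0\<close>. So the infimum is finite and below \<open>hv_lip r\<close>,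
  as the gap rate requires.\<close>

lemma (in thv_ucb_run) min_gap_real:
  assumes T: "1 \<le> T" and n: "2 \<le> n" and gs: "length gs = k" "greedy_seq (hypervolume r \<mu>) {1..n} gs"
  obtains D where "min_gap (hypervolume r \<mu>) {1..n} gs = ereal D" "0 \<le> D" "D \<le> hv_lip r"
proof -
  let ?f = "hypervolume r \<mu>" and ?g = "min_gap (hypervolume r \<mu>) {1..n} gs"
  have k: "0 < length gs" using gs k_pos by simp
  have "0 \<le> ?g"
    unfolding min_gap_def using stage_gap_nonneg[OF gs(2)] by (intro INF_greatest) auto
  obtain i where i: "i \<in> {1..n} - {gs ! 0}"
    using n by (cases "gs ! 0 = 1") (auto intro: that[of 2] that[of 1])
  have "stage_gap ?f gs 0 i \<le> ?f {gs ! 0}"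
    by (simp add: stage_gap_def marginal_def)
  also have "\<dots> \<le> hv_lip r"
    using hypervolume_mean_le[OF T] greedy_seq_nth(1)[OF gs(2) k] by simp
  finally have "?g \<le> ereal (hv_lip r)"
    using min_gap_le[OF k i, of ?f] by (meson ereal_less_eq(3) order_trans)
  then show ?thesis using \<open>0 \<le> ?g\<close> that by (cases ?g) auto
qed

theorem theorem3:
  fixes r :: "real^'d" and \<eta> :: real and m0 :: nat
  shows
    "(\<exists>C1\<ge>0. \<exists>C2\<ge>0. \<exists>C3\<ge>0.
        \<forall>n k T \<mu> (M :: 'a measure) X F S.
          thv_ucb_run M n k T r \<eta> (1 / real T) m0 \<mu> X F S \<longrightarrow>
          (let ER = (\<integral>\<omega>. approx_regret n k T r \<mu> (\<lambda>t. S t \<omega>) \<partial>M);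
               worst_case = C1 * sqrt (real n * real k * real T * ln (real T))
           in ER \<le> worst_case + C3 \<and>
              (\<forall>gs. length gs = k \<and>
                    greedy_seq (hypervolume r \<mu>) {1..n} gs \<and>
                    unique_greedy (hypervolume r \<mu>) {1..n} gs \<and>
                    (AE \<omega> in M. \<forall>t\<in>{1..T}. \<not> init_round n m0 (\<lambda>t. S t \<omega>) t \<longrightarrow>
                       set gs \<subseteq> active_arms n k \<eta> (1 / real T) (\<lambda>t. S t \<omega>) (\<lambda>i t. X i t \<omega>) t) \<longrightarrow>
                    ereal ER \<le>
                      min (ereal worst_case)
                          (ereal (C2 * (real n * real k powr (5 / 2) * ln (real T)))
                             / min_gap (hypervolume r \<mu>) {1..n} gs)
                      + ereal C3)))
     \<and>
     (\<forall>n k \<mu> (M :: 'a measure) X F S.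
        (\<forall>T\<ge>2. thv_ucb_run M n k T r \<eta> (1 / real T) m0 \<mu> X (F T) (S T)) \<longrightarrow>
        (\<lambda>T. max 0 ((\<integral>\<omega>. approx_regret n k T r \<mu> (\<lambda>t. S T t \<omega>) \<partial>M) / real T)) \<longlonglongrightarrow> 0)"
proof -
  \<comment> \<open>The absolute values are needed because positivity of \<open>\<eta>\<close> comes
    only with a run, after the constants have been chosen.\<close>
  define C1 where "C1 = hv_lip r * (3 * sqrt (2 * \<bar>\<eta>\<bar> * (4 + 2 * real CARD('d))) + 2 * real m0 + 2)"
  define C2 where "C2 = (hv_lip r)\<^sup>2 * (40 * \<bar>\<eta>\<bar> * (4 + 2 * real CARD('d)) + 2 * real m0 + 2)"
  define C3 where "C3 = 2 * hv_lip r"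
  have L: "0 < hv_lip r" by (rule hv_lip_pos)
  have C: "0 \<le> C1" "0 < C2" "0 \<le> C3"
    unfolding C1_def C2_def C3_def using L by (auto intro!: mult_nonneg_nonneg mult_pos_pos add_nonneg_pos)
  have worst: "(\<integral>\<omega>. approx_regret n k T r \<mu> (\<lambda>t. S t \<omega>) \<partial>M)
      \<le> C1 * sqrt (real n * real k * real T * ln (real T)) + C3"
    if "thv_ucb_run M n k T r \<eta> (1 / real T) m0 \<mu> X F S"
    for n k T \<mu> and M :: "'a measure" and X F S
  proof -
    interpret thv_ucb_run M n k T r \<eta> "1 / real T" m0 \<mu> X F S by (rule that)
    show ?thesis using worst_case_rate[OF refl] \<eta>_pos by (simp add: C1_def C3_def)
  qed
  have gap: "ereal (\<integral>\<omega>. approx_regret n k T r \<mu> (\<lambda>t. S t \<omega>) \<partial>M)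
      \<le> ereal (C2 * (real n * real k powr (5 / 2) * ln (real T))) / min_gap (hypervolume r \<mu>) {1..n} gs + ereal C3"
    if run: "thv_ucb_run M n k T r \<eta> (1 / real T) m0 \<mu> X F S"
      and gs: "length gs = k" "greedy_seq (hypervolume r \<mu>) {1..n} gs"
      and un: "AE \<omega> in M. \<forall>t\<in>{1..T}. \<not> init_round n m0 (\<lambda>t. S t \<omega>) t \<longrightarrow>
         set gs \<subseteq> active_arms n k \<eta> (1 / real T) (\<lambda>t. S t \<omega>) (\<lambda>i t. X i t \<omega>) t"
    for n k T \<mu> and M :: "'a measure" and X F S gs
  proof -
    interpret thv_ucb_run M n k T r \<eta> "1 / real T" m0 \<mu> X F S by (rule run)
    let ?E = "\<integral>\<omega>. approx_regret n k T r \<mu> (\<lambda>t. S t \<omega>) \<partial>M"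
    let ?A = "C2 * (real n * real k powr (5 / 2) * ln (real T))"
    let ?g = "min_gap (hypervolume r \<mu>) {1..n} gs"
    have T: "2 \<le> T" by (rule horizon_ge_2[OF refl])
    have A: "0 < ?A" using C ln_ge_half[OF T] k_pos k_le by simp
    show ?thesis
    proof (cases "n = 1")
      case True
      have g: "0 \<le> ?g"
        unfolding min_gap_def using stage_gap_nonneg[OF gs(2)] by (intro INF_greatest) auto
      have "ereal ?E \<le> 0" using expected_regret_single_arm[OF True] by simp
      also have "0 \<le> ereal ?A / ?g + ereal C3"
        unfolding divide_ereal_def using A C g
        by (intro add_nonneg_nonneg ereal_0_le_mult inverse_ereal_ge0I) auto
      finally show ?thesis .
    next
      case False
      then have "2 \<le> n" using k_pos k_le by simp
      then obtain D where D: "?g = ereal D" "0 \<le> D" "D \<le> hv_lip r"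
        using min_gap_real[OF _ _ gs] T by auto
      show ?thesis
      \<comment> \<open>A vanishing gap makes the quotient \<infinity> provided the numerator is
        strictly positive, hence the strict \<open>0 < C2\<close>.\<close>
      proof (cases "D = 0")
        case True
        have "ereal a / ereal 0 = \<infinity>" if "0 < a" for a
          using that by (simp add: divide_ereal_def)
        then have "ereal ?A / ?g = \<infinity>" unfolding D(1) True using A by blast
        then show ?thesis by simp
      next
        case False
        have "D \<le> stage_gap (hypervolume r \<mu>) gs m i" if "m < k" "i \<in> {1..n} - {gs ! m}" for m i
          using min_gap_le[of m gs i "{1..n}" "hypervolume r \<mu>"] that gs(1) D(1) by simp
        then have "?E \<le> ?A / D + C3"
          using gap_rate[OF refl _ D(3) _ gs un] D(2) False \<eta>_pos by (simp add: C2_def C3_def)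
        then show ?thesis unfolding D(1) using False by simp
      qed
    qed
  qed
  \<comment> \<open>Regret against a fraction of the optimum can be negative and of order
    \<open>T\<close>, so it is the positive part of the average that tends to 0; the lower bound of
    the sandwich is then the constant 0.\<close>
  have sublinear: "(\<lambda>T. max 0 ((\<integral>\<omega>. approx_regret n k T r \<mu> (\<lambda>t. S T t \<omega>) \<partial>M) / real T)) \<longlonglongrightarrow> 0"
    if run: "\<forall>T\<ge>2. thv_ucb_run M n k T r \<eta> (1 / real T) m0 \<mu> X (F T) (S T)"
    for n k \<mu> and M :: "'a measure" and X F S
  proof (rule tendsto_sandwich[OF _ _ tendsto_const])
    let ?b = "\<lambda>T. C1 * sqrt (real n * real k) * (sqrt (real T * ln (real T)) / real T) + C3 * (1 / real T)"
    have "(\<lambda>T::nat. sqrt (real T * ln (real T)) / real T) \<longlonglongrightarrow> 0" by real_asymp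
    moreover have "(\<lambda>T::nat. 1 / real T) \<longlonglongrightarrow> 0" by real_asymp
    ultimately show "?b \<longlonglongrightarrow> 0"
      by (intro tendsto_add_zero tendsto_mult_right_zero)
    show "\<forall>\<^sub>F T in sequentially. max 0 ((\<integral>\<omega>. approx_regret n k T r \<mu> (\<lambda>t. S T t \<omega>) \<partial>M) / real T) \<le> ?b T"
      using eventually_ge_at_top[of 2]
    proof eventually_elim
      case (elim T)
      have "(\<integral>\<omega>. approx_regret n k T r \<mu> (\<lambda>t. S T t \<omega>) \<partial>M) / real T
          \<le> (C1 * sqrt (real n * real k * real T * ln (real T)) + C3) / real T"
        using worst run elim by (intro divide_right_mono) auto
      also have "\<dots> = ?b T"
        by (simp add: real_sqrt_mult add_divide_distrib)
      finally show ?case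
        using C ln_ge_half[OF elim] by (intro max.boundedI) auto
    qed
  qed auto
  have rates: "let ER = (\<integral>\<omega>. approx_regret n k T r \<mu> (\<lambda>t. S t \<omega>) \<partial>M);
               worst_case = C1 * sqrt (real n * real k * real T * ln (real T))
           in ER \<le> worst_case + C3 \<and>
              (\<forall>gs. length gs = k \<and>
                    greedy_seq (hypervolume r \<mu>) {1..n} gs \<and>
                    unique_greedy (hypervolume r \<mu>) {1..n} gs \<and>
                    (AE \<omega> in M. \<forall>t\<in>{1..T}. \<not> init_round n m0 (\<lambda>t. S t \<omega>) t \<longrightarrow>
                       set gs \<subseteq> active_arms n k \<eta> (1 / real T) (\<lambda>t. S t \<omega>) (\<lambda>i t. X i t \<omega>) t) \<longrightarrow>
                    ereal ER \<le>
                      min (ereal worst_case)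
                          (ereal (C2 * (real n * real k powr (5 / 2) * ln (real T)))
                             / min_gap (hypervolume r \<mu>) {1..n} gs)
                      + ereal C3)"
    if run: "thv_ucb_run M n k T r \<eta> (1 / real T) m0 \<mu> X F S"
    for n k T \<mu> and M :: "'a measure" and X F S
    unfolding Let_def
  proof (intro conjI allI impI, goal_cases)
    case 1
    show ?case by (rule worst[OF run])
  next
    case (2 gs)
    have "ereal (\<integral>\<omega>. approx_regret n k T r \<mu> (\<lambda>t. S t \<omega>) \<partial>M)
        \<le> ereal (C1 * sqrt (real n * real k * real T * ln (real T))) + ereal C3"
      using worst[OF run] by simp
    then show ?case using gap[OF run] 2 by (simp only: min_def split: if_split) blast
  qed
  show ?thesis
    by (rule conjI, rule exI[of _ C1], rule conjI, rule C(1), rule exI[of _ C2], rule conjI,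
        rule less_imp_le[OF C(2)], rule exI[of _ C3], rule conjI, rule C(3))
      (intro allI impI, rule rates sublinear, assumption)+
qed

end
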